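(* Let $G$ be a finite group and $H\le Z(G)$. Let $\theta$ be a faithful unitary representation of $H$ on a Hilbert space $\mathcal{H}$, let $\mathcal{C}=\theta(H)'$ be its commutant in $B(\mathcal{H})$ with the $H$-action $h\cdot T=\theta(h)T$, and let $\mathcal{A}$ be a $C^*$-subalgebra and an $H$-submodule of $\mathcal{C}$. Let $X$ be a central $H$-modular operator space. Then the matrix form $G(\mathcal{A})\subset M_m(\mathcal{A})$ is a $C^*$-algebra $*$-isomorphic to $\mathcal{A}_G$, and $G(X)\cong X_G$ completely isometrically and as abstract $G$-ifications of $X$.
   Context: Everything is over a fixed field $\mathbb{F}\in\{\mathbb{R},\mathbb{C}\}$. Central $H$-modular operator space: an operator space $X$ with a left action of $H$ by linear complete isometries for which there are a Hilbert space $\mathcal{H}_0$, a linear complete isometry $\rho:X\to B(\mathcal{H}_0)$ and a unitary representation $\theta_0:H\to B(\mathcal{H}_0)$ with $\rho(hx)=\theta_0(h)\rho(x)=\rho(x)\theta_0(h)$ for all $h\in H$, $x\in X$. We call $(\theta_0,\rho,\mathcal{H}_0)$ a central representation. For a vector space $X$ with linear $H$-action: $X_G=\{\varphi:G\to X\mid \varphi(gh)=h^{-1}\varphi(g)\ \forall g\in G,h\in H\}$, $(\pi_X(g)\varphi)(k)=\varphi(g^{-1}k)$, and $\mathfrak{E}_X:X\to X_G$, $\mathfrak{E}_X(x)(g)=g^{-1}x$ if $g\in H$, and $0$ otherwise. Structure on $\mathcal{A}_G$ and $X_G$: $\mathcal{C}_G$ has product $(\varphi*\psi)(g)=\frac1{|H|}\sum_{k\in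 G}\varphi(k)\psi(k^{-1}g)$ and involution $\varphi^*(g)=\varphi(g^{-1})^*$. The space $\mathcal{H}_G$ (defined using the $H$-action $h\xi=\theta(h)\xi$) has the Hilbert space structure inherited from $\ell^2(G,\mathcal{H})$, and $\mathfrak{I}:\mathcal{C}_G\to B(\mathcal{H}_G)$, $[\mathfrak{I}(\Psi)\xi](g)=\frac1{|H|}\sum_{k\in G}\Psi(k)(\xi(k^{-1}g))$ is an injective $*$-homomorphism, through which $\mathcal{C}_G$ and its subalgebra $\mathcal{A}_G$ are $C^*$-algebras. For a central $H$-modular operator space $X$ with central representation $(\theta_0,\rho,\mathcal{H}_0)$, the operator space structure of $X_G$ is the one making $\varphi\mapsto\mathfrak{I}(\rho\circ\varphi)\in B((\mathcal{H}_0)_G)$ a complete isometry (with $\theta_0,\mathcal{H}_0$ in place of $\theta,\mathcal{H}$); this does not depend on the choice of representation. Matrix form: let $m=|G/H|$ and let $g_1=1,g_2,\dots,g_m$ be representatives of the cosets in $G/H$. Write $g_ig_j^{-1}=g_{r_{ij}}h_{ij}$ with $r_{ij}\in\{1,\dots,m\}$, $h_{ij}\in H$. Then $$G(X)=\{[h_{ij}^{-1}x_{r_{ij}}]_{i,j}\in M_m(X): x_1,\dots,x_m\in X\},$$ with the operator space structure inherited from $M_m(X)$. Let $V_k$ be the $m\times m$ matrix whose $(i,j)$ entry is $h_{ij}^{-1}$ if $r_{ij}=k$ and $0$ otherwise; matrices with entries in $H\cup\{0\}$ act on $M_m(X)$ by left and right matrix multiplication (with $xh:=hx$), and $G(X)=\bigoplus_k(I_m\otimes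 X)V_k=\bigoplus_k V_k(I_m\otimes X)$, where $I_m\otimes x$ is the diagonal matrix with all diagonal entries $x$. Identification as abstract $G$-ifications: $X_G$ has left action $\pi_X$, right action $(\varphi\cdot g)(k)=\varphi(kg^{-1})$ and embedding $\mathfrak{E}_X$ of $X$. $G(X)$ has left and right $G$-actions in which $g=g_kh$ ($h\in H$) acts by left, resp. right, multiplication by $V_k(I_m\otimes h)$, and embedding $x\mapsto I_m\otimes x$. Two $G$-ifications $(V,\Phi)$, $(W,\Psi)$ of $X$ (with embeddings $\Phi:X\to V$, $\Psi:X\to W$) are identified if there is a surjective complete isometry $j:V\to W$ with $j(\Phi(x)g)=\Psi(x)g$ for all $x\in X$, $g\in G$. *)

theory Defs
  imports "HOL-Analysis.Analysis" "HOL-Algebra.Left_Coset" "HOL-Library.Function_Algebras"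
begin

section \<open>The scalar field\<close>

text \<open>By the Gelfand--Mazur theorem a \<^class>\<open>real_normed_field\<close> is isomorphic to the
  reals or to the complex numbers, and the axioms below then force \<open>fcnj\<close> to be the usual
  conjugation.  A free type variable of this class thus ranges over exactly the two fields.\<close>

class real_or_complex = real_normed_field +
  fixes fcnj :: "'a \<Rightarrow> 'a"
  assumes fcnj_add: "fcnj (x + y) = fcnj x + fcnj y"
    and mult_fcnj_self: "x * fcnj x = (norm x)\<^sup>2 *\<^sub>R 1"

instantiation real :: real_or_complex
begin
definition fcnj_real :: "real \<Rightarrow> real" where "fcnj_real x = x"
instance by standard (simp_all add: fcnj_real_def power2_eq_square)
end

instantiation complex :: real_or_complex
begin
definition fcnj_complex :: "complex \<Rightarrow> complex" where "fcnj_complex x = cnj x"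
instance
  by standard (simp_all add: fcnj_complex_def complex_norm_square [symmetric] scaleR_conv_of_real del: of_real_power)
end


section \<open>Hilbert spaces, operator spaces and C*-algebras over the scalar field\<close>

text \<open>Norm and completeness of a Hilbert space are those of the \<^class>\<open>banach\<close> type; the inner
  product is linear in the first argument.\<close>

locale hilbert_space = vector_space sc
  for sc :: "'k::real_or_complex \<Rightarrow> 'h::banach \<Rightarrow> 'h" +
  fixes ip :: "'h \<Rightarrow> 'h \<Rightarrow> 'k"
  assumes sc_of_real: "sc (of_real r) x = r *\<^sub>R x"
    and ip_add_left: "ip (x + y) z = ip x z + ip y z"
    and ip_scale_left: "ip (sc c x) y = c * ip x y"
    and ip_commute: "ip y x = fcnj (ip x y)"
    and ip_self: "ip x x = of_real ((norm x)\<^sup>2)"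

text \<open>Matrices over a set \<open>S\<close> have indices \<open>0, \<dots>, n - 1\<close> and are extended by \<open>0\<close>, so
  that equality of matrices is equality of functions.  Functions (matrices, operators, maps on a
  group) are added pointwise.\<close>

definition mats :: "nat \<Rightarrow> 'v::zero set \<Rightarrow> (nat \<Rightarrow> nat \<Rightarrow> 'v) set" where
  "mats n S = {x. (\<forall>i<n. \<forall>j<n. x i j \<in> S) \<and> (\<forall>i j. \<not> (i < n \<and> j < n) \<longrightarrow> x i j = 0)}"

text \<open>The identification of \<open>M\<^sub>n(M\<^sub>m(X))\<close> with \<open>M\<^bsub>nm\<^esub>(X)\<close>.\<close>

definition flatten :: "nat \<Rightarrow> nat \<Rightarrow> (nat \<Rightarrow> nat \<Rightarrow> nat \<Rightarrow> nat \<Rightarrow> 'v::zero) \<Rightarrow> nat \<Rightarrow> nat \<Rightarrow> 'v" where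
  "flatten n m Y = (\<lambda>i j. if i < n * m \<and> j < n * m
     then Y (i div m) (j div m) (i mod m) (j mod m) else 0)"

text \<open>The norm of an \<open>n \<times> n\<close> matrix of operators, as an operator on the \<open>n\<close>-fold Hilbert sum
  of the Hilbert space with underlying set \<open>K\<close> and norm \<open>nrm\<close>.\<close>

definition mat_opnorm ::
  "'v::ab_group_add set \<Rightarrow> ('v \<Rightarrow> real) \<Rightarrow> nat \<Rightarrow> (nat \<Rightarrow> nat \<Rightarrow> 'v \<Rightarrow> 'v) \<Rightarrow> real" where
  "mat_opnorm K nrm n T =
     (SUP \<xi> \<in> {\<xi>. (\<forall>j<n. \<xi> j \<in> K) \<and> L2_set (\<lambda>j. nrm (\<xi> j)) {..<n} \<le> 1}.
        L2_set (\<lambda>i. nrm (\<Sum>j<n. T i j (\<xi> j))) {..<n})"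

text \<open>\<open>mnorm X n\<close> is the norm of \<open>M\<^sub>n(X)\<close>.\<close>

record ('k, 'v) op_space =
  elts :: "'v set"
  smul :: "'k \<Rightarrow> 'v \<Rightarrow> 'v"
  mnorm :: "nat \<Rightarrow> (nat \<Rightarrow> nat \<Rightarrow> 'v) \<Rightarrow> real"

record ('k, 'v) op_algebra = "('k, 'v) op_space" +
  amult :: "'v \<Rightarrow> 'v \<Rightarrow> 'v"
  astar :: "'v \<Rightarrow> 'v"

definition linear_between ::
  "('k, 'v::ab_group_add, 'y) op_space_scheme \<Rightarrow> ('k, 'w::ab_group_add, 'z) op_space_scheme
     \<Rightarrow> ('v \<Rightarrow> 'w) \<Rightarrow> bool" where
  "linear_between X Y f \<longleftrightarrow>
     f \<in> elts X \<rightarrow> elts Y \<and>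
     (\<forall>x\<in>elts X. \<forall>y\<in>elts X. f (x + y) = f x + f y) \<and>
     (\<forall>c. \<forall>x\<in>elts X. f (smul X c x) = smul Y c (f x))"

definition complete_isometry ::
  "('k, 'v::ab_group_add, 'y) op_space_scheme \<Rightarrow> ('k, 'w::ab_group_add, 'z) op_space_scheme
     \<Rightarrow> ('v \<Rightarrow> 'w) \<Rightarrow> bool" where
  "complete_isometry X Y f \<longleftrightarrow>
     linear_between X Y f \<and>
     (\<forall>n\<ge>1. \<forall>x\<in>mats n (elts X). mnorm Y n (\<lambda>i j. f (x i j)) = mnorm X n x)"

definition mat_space ::
  "nat \<Rightarrow> ('k, 'v::ab_group_add, 'y) op_space_scheme \<Rightarrow> ('k, nat \<Rightarrow> nat \<Rightarrow> 'v) op_space" where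
  "mat_space m X = \<lparr>
     elts = mats m (elts X),
     smul = (\<lambda>c x i j. smul X c (x i j)),
     mnorm = (\<lambda>n Y. mnorm X (n * m) (flatten n m Y))\<rparr>"

definition mat_algebra ::
  "nat \<Rightarrow> ('k, 'v::ab_group_add, 'y) op_algebra_scheme
     \<Rightarrow> ('k, nat \<Rightarrow> nat \<Rightarrow> 'v) op_algebra" where
  "mat_algebra m B = op_space.extend (mat_space m B)
     (op_algebra.fields
       (\<lambda>x y i j. if i < m \<and> j < m then (\<Sum>l<m. amult B (x i l) (y l j)) else 0)
       (\<lambda>x i j. if i < m \<and> j < m then astar B (x j i) else 0))"

definition adjoint_op :: "('h \<Rightarrow> 'h \<Rightarrow> 'k) \<Rightarrow> ('h \<Rightarrow> 'h) \<Rightarrow> 'h \<Rightarrow> 'h" where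
  "adjoint_op ip T = (THE S. \<forall>x y. ip (T x) y = ip x (S y))"

definition bounded_ops ::
  "('k::real_or_complex \<Rightarrow> 'h::banach \<Rightarrow> 'h) \<Rightarrow> ('h \<Rightarrow> 'h \<Rightarrow> 'k)
     \<Rightarrow> ('k, 'h \<Rightarrow> 'h) op_algebra" where
  "bounded_ops sc ip = \<lparr>
     elts = {T. bounded_linear T \<and> (\<forall>c x. T (sc c x) = sc c (T x))},
     smul = (\<lambda>c T x. sc c (T x)),
     mnorm = mat_opnorm UNIV norm,
     amult = (\<circ>),
     astar = adjoint_op ip\<rparr>"

definition elt_norm :: "('k, 'v::zero, 'y) op_space_scheme \<Rightarrow> 'v \<Rightarrow> real" where
  "elt_norm X x = mnorm X 1 (\<lambda>i j. if i = 0 \<and> j = 0 then x else 0)"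

text \<open>\<open>S\<close> is a C*-subalgebra of \<open>B\<close>, where \<open>B\<close> is an algebra of operators on a Hilbert space:
  a norm-closed, not necessarily unital, *-subalgebra.\<close>

definition cstar_subalgebra ::
  "('k::real_or_complex, 'v::ab_group_add, 'y) op_algebra_scheme \<Rightarrow> 'v set \<Rightarrow> bool" where
  "cstar_subalgebra B S \<longleftrightarrow>
     S \<subseteq> elts B \<and>
     module.subspace (smul B) S \<and>
     (\<forall>x\<in>S. \<forall>y\<in>S. amult B x y \<in> S) \<and>
     (\<forall>x\<in>S. astar B x \<in> S) \<and>
     (\<forall>f. \<forall>x\<in>elts B. (\<forall>n. f n \<in> S) \<and> (\<lambda>n. elt_norm B (f n - x)) \<longlonglongrightarrow> 0 \<longrightarrow> x \<in> S)"

definition star_isomorphic ::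
  "('k, 'v::ab_group_add, 'y) op_algebra_scheme \<Rightarrow> ('k, 'w::ab_group_add, 'z) op_algebra_scheme
     \<Rightarrow> bool" where
  "star_isomorphic A B \<longleftrightarrow>
     (\<exists>f. bij_betw f (elts A) (elts B) \<and> linear_between A B f \<and>
        (\<forall>x\<in>elts A. \<forall>y\<in>elts A. f (amult A x y) = amult B (f x) (f y)) \<and>
        (\<forall>x\<in>elts A. f (astar A x) = astar B (f x)))"


section \<open>Unitary representations and central H-modular operator spaces\<close>

definition group_center :: "('g, 'b) monoid_scheme \<Rightarrow> 'g set" where
  "group_center G = {z \<in> carrier G. \<forall>g\<in>carrier G. z \<otimes>\<^bsub>G\<^esub> g = g \<otimes>\<^bsub>G\<^esub> z}"

definition unitary_rep ::
  "('g, 'b) monoid_scheme \<Rightarrow> 'g set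
     \<Rightarrow> ('k::real_or_complex \<Rightarrow> 'h::banach \<Rightarrow> 'h) \<Rightarrow> ('h \<Rightarrow> 'h \<Rightarrow> 'k)
     \<Rightarrow> ('g \<Rightarrow> 'h \<Rightarrow> 'h) \<Rightarrow> bool" where
  "unitary_rep G H sc ip \<theta> \<longleftrightarrow>
     (\<forall>h\<in>H. \<theta> h \<in> elts (bounded_ops sc ip) \<and> surj (\<theta> h) \<and>
        (\<forall>x y. ip (\<theta> h x) (\<theta> h y) = ip x y)) \<and>
     \<theta> \<one>\<^bsub>G\<^esub> = id \<and>
     (\<forall>h\<in>H. \<forall>k\<in>H. \<theta> (h \<otimes>\<^bsub>G\<^esub> k) = \<theta> h \<circ> \<theta> k)"

definition commutant ::
  "('k::real_or_complex \<Rightarrow> 'h::banach \<Rightarrow> 'h) \<Rightarrow> ('h \<Rightarrow> 'h \<Rightarrow> 'k) \<Rightarrow> 'g set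
     \<Rightarrow> ('g \<Rightarrow> 'h \<Rightarrow> 'h) \<Rightarrow> ('h \<Rightarrow> 'h) set" where
  "commutant sc ip H \<theta> = {T \<in> elts (bounded_ops sc ip). \<forall>h\<in>H. T \<circ> \<theta> h = \<theta> h \<circ> T}"

definition isometric_action ::
  "('g, 'b) monoid_scheme \<Rightarrow> 'g set \<Rightarrow> ('k, 'x::ab_group_add, 'y) op_space_scheme
     \<Rightarrow> ('g \<Rightarrow> 'x \<Rightarrow> 'x) \<Rightarrow> bool" where
  "isometric_action G H X act \<longleftrightarrow>
     (\<forall>h\<in>H. complete_isometry X X (act h)) \<and>
     (\<forall>x\<in>elts X. act \<one>\<^bsub>G\<^esub> x = x) \<and>
     (\<forall>h\<in>H. \<forall>k\<in>H. \<forall>x\<in>elts X. act (h \<otimes>\<^bsub>G\<^esub> k) x = act h (act k x))"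

text \<open>\<open>X\<close> is an operator space: a vector space with matrix norms which is linearly completely
  isometric to a space of bounded operators on a Hilbert space, the isometry being \<open>\<rho>\<close>.
  Completeness is not required.  The Hilbert space is a parameter here because it is not possible
  to quantify existentially over types.\<close>

definition operator_space_via ::
  "('k::real_or_complex, 'x::ab_group_add, 'y) op_space_scheme
     \<Rightarrow> ('k \<Rightarrow> 'h::banach \<Rightarrow> 'h) \<Rightarrow> ('h \<Rightarrow> 'h \<Rightarrow> 'k) \<Rightarrow> ('x \<Rightarrow> 'h \<Rightarrow> 'h) \<Rightarrow> bool" where
  "operator_space_via X sc ip \<rho> \<longleftrightarrow>
     hilbert_space sc ip \<and> vector_space (smul X) \<and> module.subspace (smul X) (elts X) \<and>
     complete_isometry X (bounded_ops sc ip) \<rho>"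

definition central_H_modular_via ::
  "('g, 'b) monoid_scheme \<Rightarrow> 'g set
     \<Rightarrow> ('k::real_or_complex, 'x::ab_group_add, 'y) op_space_scheme \<Rightarrow> ('g \<Rightarrow> 'x \<Rightarrow> 'x)
     \<Rightarrow> ('k \<Rightarrow> 'h::banach \<Rightarrow> 'h) \<Rightarrow> ('h \<Rightarrow> 'h \<Rightarrow> 'k) \<Rightarrow> ('g \<Rightarrow> 'h \<Rightarrow> 'h) \<Rightarrow> ('x \<Rightarrow> 'h \<Rightarrow> 'h)
     \<Rightarrow> bool" where
  "central_H_modular_via G H X act sc ip \<theta> \<rho> \<longleftrightarrow>
     operator_space_via X sc ip \<rho> \<and> isometric_action G H X act \<and> unitary_rep G H sc ip \<theta> \<and>
     (\<forall>h\<in>H. \<forall>x\<in>elts X. \<rho> (act h x) = \<theta> h \<circ> \<rho> x \<and> \<rho> (act h x) = \<rho> x \<circ> \<theta> h)"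


section \<open>Induced modules\<close>

text \<open>Functions on \<open>G\<close> are extended by \<open>0\<close> outside the carrier of \<open>G\<close>.\<close>

definition induced ::
  "('g, 'b) monoid_scheme \<Rightarrow> 'g set \<Rightarrow> ('g \<Rightarrow> 'v \<Rightarrow> 'v) \<Rightarrow> 'v::zero set \<Rightarrow> ('g \<Rightarrow> 'v) set" where
  "induced G H act S = {\<phi>.
     (\<forall>g\<in>carrier G. \<phi> g \<in> S) \<and> (\<forall>g. g \<notin> carrier G \<longrightarrow> \<phi> g = 0) \<and>
     (\<forall>g\<in>carrier G. \<forall>h\<in>H. \<phi> (g \<otimes>\<^bsub>G\<^esub> h) = act (inv\<^bsub>G\<^esub> h) (\<phi> g))}"

definition conv_op ::
  "('g, 'b) monoid_scheme \<Rightarrow> 'g set \<Rightarrow> ('g \<Rightarrow> 'h \<Rightarrow> 'h::real_vector)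
     \<Rightarrow> ('g \<Rightarrow> 'h) \<Rightarrow> ('g \<Rightarrow> 'h)" where
  "conv_op G H \<Psi> \<xi> = (\<lambda>g. if g \<in> carrier G
     then (1 / real (card H)) *\<^sub>R (\<Sum>k\<in>carrier G. \<Psi> k (\<xi> (inv\<^bsub>G\<^esub> k \<otimes>\<^bsub>G\<^esub> g))) else 0)"

text \<open>The norm of a matrix of operators on the Hilbert space induced from the action \<open>\<theta>\<close> of \<open>H\<close>
  on the type \<open>'h\<close>, with the norm of \<open>\<ell>\<^sup>2(G, 'h)\<close>.\<close>

definition induced_opnorm ::
  "('g, 'b) monoid_scheme \<Rightarrow> 'g set \<Rightarrow> ('g \<Rightarrow> 'h \<Rightarrow> 'h::real_normed_vector)
     \<Rightarrow> nat \<Rightarrow> (nat \<Rightarrow> nat \<Rightarrow> ('g \<Rightarrow> 'h) \<Rightarrow> ('g \<Rightarrow> 'h)) \<Rightarrow> real" where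
  "induced_opnorm G H \<theta> =
     mat_opnorm (induced G H \<theta> UNIV) (\<lambda>\<xi>. L2_set (\<lambda>g. norm (\<xi> g)) (carrier G))"

text \<open>For \<open>A\<close> a subalgebra and submodule of the commutant of \<open>\<theta>(H)\<close>, with \<open>h\<close> acting on operators
  as composition with \<open>\<theta> h\<close>.\<close>

definition induced_algebra ::
  "('g, 'b) monoid_scheme \<Rightarrow> 'g set
     \<Rightarrow> ('k::real_or_complex \<Rightarrow> 'h::banach \<Rightarrow> 'h) \<Rightarrow> ('h \<Rightarrow> 'h \<Rightarrow> 'k)
     \<Rightarrow> ('g \<Rightarrow> 'h \<Rightarrow> 'h) \<Rightarrow> ('h \<Rightarrow> 'h) set \<Rightarrow> ('k, 'g \<Rightarrow> 'h \<Rightarrow> 'h) op_algebra" where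
  "induced_algebra G H sc ip \<theta> A = \<lparr>
     elts = induced G H (\<lambda>h T. \<theta> h \<circ> T) A,
     smul = (\<lambda>c \<phi> g x. sc c (\<phi> g x)),
     mnorm = (\<lambda>n \<Phi>. induced_opnorm G H \<theta> n (\<lambda>i j. conv_op G H (\<Phi> i j))),
     amult = (\<lambda>\<phi> \<psi> g x. if g \<in> carrier G
       then (1 / real (card H)) *\<^sub>R (\<Sum>k\<in>carrier G. \<phi> k (\<psi> (inv\<^bsub>G\<^esub> k \<otimes>\<^bsub>G\<^esub> g) x)) else 0),
     astar = (\<lambda>\<phi> g. if g \<in> carrier G then adjoint_op ip (\<phi> (inv\<^bsub>G\<^esub> g)) else 0)\<rparr>"


section \<open>The matrix form\<close>

definition coset_reps ::
  "('g, 'b) monoid_scheme \<Rightarrow> 'g set \<Rightarrow> nat \<Rightarrow> (nat \<Rightarrow> 'g) \<Rightarrow> bool" where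
  "coset_reps G H m rep \<longleftrightarrow>
     m = card (lcosets\<^bsub>G\<^esub> H) \<and> rep 0 = \<one>\<^bsub>G\<^esub> \<and> rep \<in> {..<m} \<rightarrow> carrier G \<and>
     bij_betw (\<lambda>i. rep i <#\<^bsub>G\<^esub> H) {..<m} (lcosets\<^bsub>G\<^esub> H)"

text \<open>Every \<open>g\<close> is uniquely \<open>rep k \<otimes> h\<close> with \<open>k = coset_index g\<close> and \<open>h = H_part g\<close> in \<open>H\<close>.\<close>

definition coset_index ::
  "('g, 'b) monoid_scheme \<Rightarrow> 'g set \<Rightarrow> nat \<Rightarrow> (nat \<Rightarrow> 'g) \<Rightarrow> 'g \<Rightarrow> nat" where
  "coset_index G H m rep g = (THE k. k < m \<and> g \<in> rep k <#\<^bsub>G\<^esub> H)"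

definition H_part ::
  "('g, 'b) monoid_scheme \<Rightarrow> 'g set \<Rightarrow> nat \<Rightarrow> (nat \<Rightarrow> 'g) \<Rightarrow> 'g \<Rightarrow> 'g" where
  "H_part G H m rep g = inv\<^bsub>G\<^esub> (rep (coset_index G H m rep g)) \<otimes>\<^bsub>G\<^esub> g"

definition r_index ::
  "('g, 'b) monoid_scheme \<Rightarrow> 'g set \<Rightarrow> nat \<Rightarrow> (nat \<Rightarrow> 'g) \<Rightarrow> nat \<Rightarrow> nat \<Rightarrow> nat" where
  "r_index G H m rep i j = coset_index G H m rep (rep i \<otimes>\<^bsub>G\<^esub> inv\<^bsub>G\<^esub> (rep j))"

definition h_elem ::
  "('g, 'b) monoid_scheme \<Rightarrow> 'g set \<Rightarrow> nat \<Rightarrow> (nat \<Rightarrow> 'g) \<Rightarrow> nat \<Rightarrow> nat \<Rightarrow> 'g" where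
  "h_elem G H m rep i j = H_part G H m rep (rep i \<otimes>\<^bsub>G\<^esub> inv\<^bsub>G\<^esub> (rep j))"

definition matrix_form ::
  "('g, 'b) monoid_scheme \<Rightarrow> 'g set \<Rightarrow> nat \<Rightarrow> (nat \<Rightarrow> 'g) \<Rightarrow> ('g \<Rightarrow> 'v \<Rightarrow> 'v) \<Rightarrow> 'v::zero set
     \<Rightarrow> (nat \<Rightarrow> nat \<Rightarrow> 'v) set" where
  "matrix_form G H m rep act S =
     {(\<lambda>i j. if i < m \<and> j < m
         then act (inv\<^bsub>G\<^esub> (h_elem G H m rep i j)) (x (r_index G H m rep i j)) else 0)
      | x. \<forall>k<m. x k \<in> S}"

text \<open>A matrix with entries in \<open>H \<union> {0}\<close> is a matrix of options, \<open>None\<close> standing for \<open>0\<close>.  The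
  right action of \<open>H\<close> on \<open>X\<close> is \<open>x h = h x\<close>.\<close>

definition opt_act :: "('g \<Rightarrow> 'v \<Rightarrow> 'v) \<Rightarrow> 'g option \<Rightarrow> 'v \<Rightarrow> 'v::zero" where
  "opt_act act w x = (case w of None \<Rightarrow> 0 | Some h \<Rightarrow> act h x)"

definition left_mult ::
  "nat \<Rightarrow> ('g \<Rightarrow> 'v \<Rightarrow> 'v) \<Rightarrow> (nat \<Rightarrow> nat \<Rightarrow> 'g option) \<Rightarrow> (nat \<Rightarrow> nat \<Rightarrow> 'v)
     \<Rightarrow> nat \<Rightarrow> nat \<Rightarrow> 'v::ab_group_add" where
  "left_mult m act W x = (\<lambda>i j. if i < m \<and> j < m
     then (\<Sum>l<m. opt_act act (W i l) (x l j)) else 0)"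

definition right_mult ::
  "nat \<Rightarrow> ('g \<Rightarrow> 'v \<Rightarrow> 'v) \<Rightarrow> (nat \<Rightarrow> nat \<Rightarrow> 'v) \<Rightarrow> (nat \<Rightarrow> nat \<Rightarrow> 'g option)
     \<Rightarrow> nat \<Rightarrow> nat \<Rightarrow> 'v::ab_group_add" where
  "right_mult m act x W = (\<lambda>i j. if i < m \<and> j < m
     then (\<Sum>l<m. opt_act act (W l j) (x i l)) else 0)"

definition V_mat ::
  "('g, 'b) monoid_scheme \<Rightarrow> 'g set \<Rightarrow> nat \<Rightarrow> (nat \<Rightarrow> 'g) \<Rightarrow> nat \<Rightarrow> nat \<Rightarrow> nat \<Rightarrow> 'g option" where
  "V_mat G H m rep k = (\<lambda>i j. if r_index G H m rep i j = k
     then Some (inv\<^bsub>G\<^esub> (h_elem G H m rep i j)) else None)"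

definition I_tensor_H :: "'g \<Rightarrow> nat \<Rightarrow> nat \<Rightarrow> 'g option" where
  "I_tensor_H h = (\<lambda>i j. if i = j then Some h else None)"

definition I_tensor :: "nat \<Rightarrow> 'v::zero \<Rightarrow> nat \<Rightarrow> nat \<Rightarrow> 'v" where
  "I_tensor m x = (\<lambda>i j. if i = j \<and> i < m then x else 0)"


section \<open>G-ifications\<close>

record ('k, 'g, 'x, 'v) gification = "('k, 'v) op_space" +
  lact :: "'g \<Rightarrow> 'v \<Rightarrow> 'v"
  ract :: "'v \<Rightarrow> 'g \<Rightarrow> 'v"
  emb :: "'x \<Rightarrow> 'v"

text \<open>Identification is through the right actions and the embeddings only; compatibility with the
  left actions is not part of it.\<close>

definition gifications_identified ::
  "('a, 'b) monoid_scheme \<Rightarrow> ('k, 'x, 'z) op_space_scheme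
     \<Rightarrow> ('k, 'a, 'x, 'v::ab_group_add) gification \<Rightarrow> ('k, 'a, 'x, 'w::ab_group_add) gification
     \<Rightarrow> bool" where
  "gifications_identified G X V W \<longleftrightarrow>
     (\<exists>j. complete_isometry V W j \<and> j ` elts V = elts W \<and>
        (\<forall>x\<in>elts X. \<forall>g\<in>carrier G. j (ract V (emb V x) g) = ract W (emb W x) g))"

text \<open>\<open>X\<^sub>G\<close>, with the operator space structure given by the central representation \<open>(\<theta>, \<rho>)\<close>.\<close>

definition induced_gification ::
  "('g, 'b) monoid_scheme \<Rightarrow> 'g set \<Rightarrow> ('k, 'x::ab_group_add, 'z) op_space_scheme
     \<Rightarrow> ('g \<Rightarrow> 'x \<Rightarrow> 'x) \<Rightarrow> ('g \<Rightarrow> 'h \<Rightarrow> 'h) \<Rightarrow> ('x \<Rightarrow> 'h \<Rightarrow> 'h::real_normed_vector)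
     \<Rightarrow> ('k, 'g, 'x, 'g \<Rightarrow> 'x) gification" where
  "induced_gification G H X act \<theta> \<rho> = \<lparr>
     elts = induced G H act (elts X),
     smul = (\<lambda>c \<phi> g. smul X c (\<phi> g)),
     mnorm = (\<lambda>n \<Phi>. induced_opnorm G H \<theta> n (\<lambda>i j. conv_op G H (\<lambda>k. \<rho> (\<Phi> i j k)))),
     lact = (\<lambda>g \<phi> k. if k \<in> carrier G then \<phi> (inv\<^bsub>G\<^esub> g \<otimes>\<^bsub>G\<^esub> k) else 0),
     ract = (\<lambda>\<phi> g k. if k \<in> carrier G then \<phi> (k \<otimes>\<^bsub>G\<^esub> inv\<^bsub>G\<^esub> g) else 0),
     emb = (\<lambda>x g. if g \<in> H then act (inv\<^bsub>G\<^esub> g) x else 0)\<rparr>"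

text \<open>\<open>G(X)\<close>: the element \<open>g = rep k \<otimes> h\<close> acts by multiplication by \<open>V\<^sub>k (I\<^sub>m \<otimes> h)\<close>, written here as
  two successive multiplications.\<close>

definition matrix_gification ::
  "('g, 'b) monoid_scheme \<Rightarrow> 'g set \<Rightarrow> nat \<Rightarrow> (nat \<Rightarrow> 'g)
     \<Rightarrow> ('k, 'x::ab_group_add, 'z) op_space_scheme \<Rightarrow> ('g \<Rightarrow> 'x \<Rightarrow> 'x)
     \<Rightarrow> ('k, 'g, 'x, nat \<Rightarrow> nat \<Rightarrow> 'x) gification" where
  "matrix_gification G H m rep X act = \<lparr>
     elts = matrix_form G H m rep act (elts X),
     smul = smul (mat_space m X),
     mnorm = mnorm (mat_space m X),
     lact = (\<lambda>g y. left_mult m act (V_mat G H m rep (coset_index G H m rep g))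
              (left_mult m act (I_tensor_H (H_part G H m rep g)) y)),
     ract = (\<lambda>y g. right_mult m act
              (right_mult m act y (V_mat G H m rep (coset_index G H m rep g)))
              (I_tensor_H (H_part G H m rep g))),
     emb = I_tensor m\<rparr>"

end

theory Submission
  imports Defs
begin

text \<open>An induced function \<open>\<phi>\<close> is determined by its values at the coset representatives
  \<open>g\<^sub>0 = 1, g\<^sub>1, \<dots>, g\<^bsub>m-1\<^esub>\<close>.  If \<open>g\<^sub>i g\<^sub>j\<^sup>-\<^sup>1 = g\<^sub>r h\<close> with \<open>h\<close> in \<open>H\<close>, then \<open>\<phi>(g\<^sub>i g\<^sub>j\<^sup>-\<^sup>1) = h\<^sup>-\<^sup>1 \<phi>(g\<^sub>r)\<close>, so
  that the matrix form consists exactly of the matrices \<open>[\<phi>(g\<^sub>i g\<^sub>j\<^sup>-\<^sup>1)]\<close> with \<open>\<phi>\<close> induced.  The map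
  \<open>\<phi> \<mapsto> [\<phi>(g\<^sub>i g\<^sub>j\<^sup>-\<^sup>1)]\<close> is a bijection (lemma \<open>bij_coset_function\<close> for its inverse), and its inverse
  realizes both isomorphisms of the theorem.

  The main computation concerns the convolution operator \<open>\<I>(\<Psi>)\<close> of a symbol \<open>\<Psi>\<close> with values in
  the commutant of \<open>\<theta>(H)\<close>.  After the substitution \<open>k = g l\<^sup>-\<^sup>1\<close> the summand is
  \<open>\<Psi>(g l\<^sup>-\<^sup>1) \<xi>(l)\<close>; replacing \<open>l\<close> by \<open>lh\<close> with \<open>h\<close> in the central subgroup \<open>H\<close> produces
  \<open>\<theta>(h)\<close> from \<open>\<Psi>\<close> and \<open>\<theta>(h)\<^sup>-\<^sup>1\<close> from \<open>\<xi>\<close>, which cancel because \<open>\<Psi>\<close> commutes with \<open>\<theta>(H)\<close>.  The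
  factor \<open>1/|H|\<close> therefore leaves a sum over the representatives,
  \<open>(\<I>(\<Psi>)\<xi>)(g\<^sub>i) = \<Sum>\<^sub>j \<Psi>(g\<^sub>i g\<^sub>j\<^sup>-\<^sup>1) \<xi>(g\<^sub>j)\<close> (lemma \<open>conv_op_eq\<close>).

  Applied to the columns of a second symbol, this identity says that convolution becomes matrix
  multiplication (\<open>coset_matrix_mult\<close>).  Since \<open>\<xi> \<mapsto> (|H|\<^bsup>1/2\<^esup> \<xi>(g\<^sub>j))\<^sub>j\<close> is unitary from the induced
  Hilbert space onto the \<open>m\<close>-fold sum, it also says that \<open>\<I>(\<Psi>)\<close> and the matrix
  \<open>[\<Psi>(g\<^sub>i g\<^sub>j\<^sup>-\<^sup>1)]\<close> are unitarily equivalent, hence that the operator space structures agree at every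
  matrix level (\<open>induced_opnorm_eq\<close>).  That the involution preserves the induced algebra uses
  \<open>(\<theta>(h)T)\<^sup>* = \<theta>(h)\<^sup>-\<^sup>1 T\<^sup>*\<close> and so the existence of adjoints, which is derived from the representation
  theorem for bounded functionals.  Norm-closedness of the matrix form is entrywise.\<close>

section \<open>Adjoints on Hilbert spaces over the scalar field\<close>

text \<open>All properties of the conjugation follow from this explicit formula.\<close>

lemma fcnj_eq: "fcnj x = (norm x)\<^sup>2 *\<^sub>R inverse (x :: 'k::real_or_complex)"
proof (cases "x = 0")
  case True
  have "fcnj (0::'k) = fcnj (0 + 0)" by simp
  then have "fcnj (0::'k) = 0" unfolding fcnj_add by simp
  with True show ?thesis by simp
next
  case False
  have "inverse x * (x * fcnj x) = inverse x * ((norm x)\<^sup>2 *\<^sub>R 1)"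
    by (simp only: mult_fcnj_self)
  with False show ?thesis by (simp add: mult.assoc [symmetric])
qed

lemma fcnj_mult: "fcnj (x * y) = fcnj x * fcnj (y :: 'k::real_or_complex)"
  by (simp add: fcnj_eq norm_mult power_mult_distrib mult_ac)

lemma fcnj_of_real [simp]: "fcnj (of_real r :: 'k::real_or_complex) = of_real r"
  by (cases "r = 0") (simp_all add: fcnj_eq scaleR_conv_of_real power2_eq_square flip: of_real_mult of_real_inverse)

context hilbert_space
begin

lemma ip_zero_left [simp]: "ip 0 y = 0"
  using ip_add_left [of 0 0 y] by simp

lemma ip_minus_left [simp]: "ip (- x) y = - ip x y"
  using ip_add_left [of x "- x" y] by (simp add: eq_neg_iff_add_eq_0 add.commute)

lemma ip_diff_left: "ip (x - y) z = ip x z - ip y z"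
  using ip_add_left [of x "- y" z] by simp

lemma ip_add_right: "ip x (y + z) = ip x y + ip x z"
  by (metis fcnj_add ip_add_left ip_commute)

lemma ip_zero_right [simp]: "ip x 0 = 0"
  using ip_add_right [of x 0 0] by simp

lemma ip_minus_right [simp]: "ip x (- y) = - ip x y"
  using ip_add_right [of x y "- y"] by (simp add: eq_neg_iff_add_eq_0 add.commute)

lemma ip_diff_right: "ip x (y - z) = ip x y - ip x z"
  using ip_add_right [of x y "- z"] by simp

lemma ip_scale_right: "ip x (sc c y) = fcnj c * ip x y"
  by (metis fcnj_mult ip_commute ip_scale_left)

lemma parallelogram:
  fixes x y :: 'h
  shows "(norm (x + y))\<^sup>2 + (norm (x - y))\<^sup>2 = 2 * (norm x)\<^sup>2 + 2 * (norm y)\<^sup>2"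
proof -
  have "(of_real ((norm (x + y))\<^sup>2) + of_real ((norm (x - y))\<^sup>2) :: 'k)
      = 2 * of_real ((norm x)\<^sup>2) + 2 * of_real ((norm y)\<^sup>2)"
    unfolding ip_self [symmetric]
    by (simp add: ip_add_left ip_add_right ip_diff_left ip_diff_right)
  then have "(of_real ((norm (x + y))\<^sup>2 + (norm (x - y))\<^sup>2) :: 'k)
      = of_real (2 * (norm x)\<^sup>2 + 2 * (norm y)\<^sup>2)"
    by simp
  then show ?thesis unfolding of_real_eq_iff .
qed

text \<open>This yields both the Cauchy--Schwarz inequality and, in the representation theorem, the
  orthogonality of the minimizer to the kernel.\<close>

lemma norm_diff_projection:
  assumes "y \<noteq> 0"
  shows "(norm (x - sc (ip x y / of_real ((norm y)\<^sup>2)) y))\<^sup>2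
       = (norm x)\<^sup>2 - (norm (ip x y))\<^sup>2 / (norm y)\<^sup>2"
proof -
  define c where "c = ip x y / of_real ((norm y)\<^sup>2)"
  have yy: "(of_real ((norm y)\<^sup>2) :: 'k) \<noteq> 0" using assms by simp
  have abs: "ip x y * fcnj (ip x y) = of_real ((norm (ip x y))\<^sup>2)"
    by (simp add: mult_fcnj_self scaleR_conv_of_real)
  have fc: "fcnj c = fcnj (ip x y) / of_real ((norm y)\<^sup>2)"
    by (metis c_def divide_inverse fcnj_mult fcnj_of_real of_real_inverse)
  have "(of_real ((norm (x - sc c y))\<^sup>2) :: 'k)
      = ip x x - fcnj c * ip x y - c * (ip y x - fcnj c * ip y y)"
    unfolding ip_self [symmetric]
    by (simp add: ip_diff_left ip_diff_right ip_scale_left ip_scale_right algebra_simps)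
  also have "\<dots> = of_real ((norm x)\<^sup>2) - (ip x y * fcnj (ip x y)) / of_real ((norm y)\<^sup>2)"
    using yy unfolding ip_self fc ip_commute [of y x] by (simp add: c_def)
  also have "\<dots> = of_real ((norm x)\<^sup>2 - (norm (ip x y))\<^sup>2 / (norm y)\<^sup>2)"
    unfolding abs by simp
  finally show ?thesis unfolding of_real_eq_iff c_def .
qed

lemma Cauchy_Schwarz: "norm (ip x y) \<le> norm x * norm y"
proof (cases "y = 0")
  case True
  then show ?thesis by simp
next
  case False
  have "0 \<le> (norm x)\<^sup>2 - (norm (ip x y))\<^sup>2 / (norm y)\<^sup>2"
    unfolding norm_diff_projection [OF False, symmetric] by simp
  then have "(norm (ip x y))\<^sup>2 \<le> (norm x * norm y)\<^sup>2"
    using False by (simp add: field_simps)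
  then show ?thesis by (rule power2_le_imp_le) simp
qed

text \<open>The representing vector is a real multiple of the element of least norm in the affine
  hyperplane where the functional is \<open>1\<close>; this element exists because a minimizing sequence is
  Cauchy by the parallelogram law.\<close>

lemma riesz_representation:
  assumes add: "\<And>x y. f (x + y) = f x + f y"
    and scale: "\<And>c x. f (sc c x) = c * f x"
    and bound: "\<And>x. norm (f x) \<le> norm x * K"
  shows "\<exists>u. \<forall>x. f x = ip x u"
proof (cases "\<forall>x. f x = 0")
  case True
  then show ?thesis by (intro exI [of _ 0]) simp
next
  case False
  have fR: "f (r *\<^sub>R x) = r *\<^sub>R f x" for r x
    by (metis scale sc_of_real scaleR_conv_of_real)
  interpret f: bounded_linear f
    using add fR bound by (rule bounded_linear_intro)
  define S where "S = {x. f x = 1}"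
  obtain x0 where "f x0 \<noteq> 0" using False by blast
  then have "sc (inverse (f x0)) x0 \<in> S" by (simp add: S_def scale)
  then have Sne: "S \<noteq> {}" by blast
  define D where "D = (INF x\<in>S. (norm x)\<^sup>2)"
  have bdd: "bdd_below ((\<lambda>x. (norm x)\<^sup>2) ` S)" by (rule bdd_belowI [of _ 0]) auto
  have D_le: "D \<le> (norm x)\<^sup>2" if "x \<in> S" for x
    unfolding D_def using bdd that by (rule cINF_lower)
  have "\<exists>x\<in>S. (norm x)\<^sup>2 < D + e" if "e > 0" for e
    using cINF_less_iff [OF Sne bdd, of "D + e"] that by (simp add: D_def)
  then have "\<forall>n. \<exists>x\<in>S. (norm x)\<^sup>2 < D + inverse (real (Suc n))" by simp
  then obtain X where XS: "\<And>n. X n \<in> S"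
      and XD: "\<And>n. (norm (X n))\<^sup>2 < D + inverse (real (Suc n))" by metis
  have close: "(norm (X k - X l))\<^sup>2 \<le> 2 * inverse (real (Suc k)) + 2 * inverse (real (Suc l))" for k l
  proof -
    have "(1/2) *\<^sub>R (X k + X l) \<in> S"
      using XS [of k] XS [of l] scaleR_half_double [of "1 :: 'k"]
      by (simp add: S_def fR add)
    then have "D \<le> (norm ((1/2) *\<^sub>R (X k + X l)))\<^sup>2" by (rule D_le)
    also have "\<dots> = (norm (X k + X l))\<^sup>2 / 4" by (simp add: power_divide)
    finally show ?thesis
      using parallelogram [of "X k" "X l"] XD [of k] XD [of l] by argo
  qed
  have "Cauchy X"
  proof (rule CauchyI)
    fix e :: real assume "e > 0"
    then obtain N where N: "inverse (real (Suc N)) < e\<^sup>2 / 4"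
      using reals_Archimedean [of "e\<^sup>2 / 4"] by auto
    have "norm (X k - X l) < e" if "k \<ge> N" "l \<ge> N" for k l
    proof -
      have "inverse (real (Suc k)) \<le> inverse (real (Suc N))"
        "inverse (real (Suc l)) \<le> inverse (real (Suc N))"
        using that by (simp_all add: field_simps)
      with close [of k l] N have "(norm (X k - X l))\<^sup>2 < e\<^sup>2" by argo
      then show ?thesis by (rule power2_less_imp_less) (use \<open>e > 0\<close> in simp)
    qed
    then show "\<exists>M. \<forall>m\<ge>M. \<forall>n\<ge>M. norm (X m - X n) < e" by blast
  qed
  then obtain u where u: "X \<longlonglongrightarrow> u" by (auto simp: Cauchy_convergent_iff convergent_def)
  have "(\<lambda>n. f (X n)) \<longlonglongrightarrow> f u" by (rule f.tendsto [OF u])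
  then have fu: "f u = 1" using XS by (simp add: S_def LIMSEQ_const_iff)
  have "(\<lambda>n. D + inverse (real (Suc n))) \<longlonglongrightarrow> D + 0"
    by (intro tendsto_intros LIMSEQ_inverse_real_of_nat)
  moreover have "(\<lambda>n. (norm (X n))\<^sup>2) \<longlonglongrightarrow> (norm u)\<^sup>2" by (intro tendsto_intros u)
  ultimately have uD: "(norm u)\<^sup>2 \<le> D"
    using XD by (intro LIMSEQ_le [of "\<lambda>n. (norm (X n))\<^sup>2"]) (auto intro: less_imp_le)
  have orth: "ip z u = 0" if z: "f z = 0" for z
  proof (cases "z = 0")
    case False
    define w where "w = u - sc (ip u z / of_real ((norm z)\<^sup>2)) z"
    have "w \<in> S" by (simp add: w_def S_def f.diff scale z fu)
    then have "(norm u)\<^sup>2 \<le> (norm w)\<^sup>2" using D_le uD by (meson order_trans)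
    also have "\<dots> = (norm u)\<^sup>2 - (norm (ip u z))\<^sup>2 / (norm z)\<^sup>2"
      unfolding w_def by (rule norm_diff_projection [OF False])
    finally have "ip u z = 0" using False
      by (simp add: divide_le_0_iff)
    then show ?thesis
      using ip_commute [of z u] fcnj_of_real [of 0] by simp
  qed simp
  have "f x = ip x (sc (of_real (1 / (norm u)\<^sup>2)) u)" for x
  proof -
    have "ip (x - sc (f x) u) u = 0" by (rule orth) (simp add: f.diff scale fu)
    then have "ip x u = f x * of_real ((norm u)\<^sup>2)"
      by (simp add: ip_diff_left ip_scale_left ip_self)
    moreover have "u \<noteq> 0" using fu f.zero by auto
    ultimately show ?thesis unfolding ip_scale_right fcnj_of_real by simp
  qed
  then show ?thesis by blast
qed

lemma ip_left_eqD: "y = z" if "\<And>x. ip x y = ip x z"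
proof -
  have "ip (y - z) (y - z) = 0" using that by (simp add: ip_diff_right)
  then show ?thesis by (simp add: ip_self)
qed

lemma adjoint_op_eqI: "adjoint_op ip T = S" if "\<And>x y. ip (T x) y = ip x (S y)"
  unfolding adjoint_op_def
proof (rule the_equality)
  fix S' assume "\<forall>x y. ip (T x) y = ip x (S' y)"
  then have "S' y = S y" for y by (intro ip_left_eqD) (simp flip: that)
  then show "S' = S" by blast
qed (use that in blast)

text \<open>The description defining \<^const>\<open>adjoint_op\<close> is proper: bounded operators have adjoints.\<close>

lemma ip_adjoint_op:
  assumes "T \<in> elts (bounded_ops sc ip)"
  shows "ip (T x) y = ip x (adjoint_op ip T y)"
proof -
  interpret T: bounded_linear T using assms by (simp add: bounded_ops_def)
  obtain K where K: "\<And>x. norm (T x) \<le> norm x * K" using T.bounded by blast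
  have "\<exists>u. \<forall>x. ip (T x) y = ip x u" for y
  proof (rule riesz_representation)
    show "norm (ip (T x) y) \<le> norm x * (K * norm y)" for x
    proof -
      have "norm (ip (T x) y) \<le> norm (T x) * norm y" by (rule Cauchy_Schwarz)
      also have "\<dots> \<le> norm x * K * norm y" by (intro mult_right_mono K) simp
      finally show ?thesis by (simp add: mult.assoc)
    qed
  qed (use assms in \<open>simp_all add: T.add ip_add_left ip_scale_left bounded_ops_def\<close>)
  then obtain S where S: "\<And>x y. ip (T x) y = ip x (S y)" by metis
  then show ?thesis using adjoint_op_eqI by metis
qed

lemma norm_eq_of_ip_eq: "norm x = norm y" if "ip x x = ip y y"
  using that unfolding ip_self of_real_eq_iff by simp

end

section \<open>Cosets of a central subgroup and the matrix form\<close>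

text \<open>The symbol for strict multiset inclusion would make the notation for left cosets ambiguous.\<close>

no_notation subset_mset  (infix \<open><#\<close> 50)

text \<open>The matrix \<open>[\<phi>(g\<^sub>i g\<^sub>j\<^sup>-\<^sup>1)]\<close> of a function \<open>\<phi>\<close> on the group, extended by \<open>0\<close>.\<close>

definition coset_matrix ::
  "('g, 'b) monoid_scheme \<Rightarrow> nat \<Rightarrow> (nat \<Rightarrow> 'g) \<Rightarrow> ('g \<Rightarrow> 'v::zero) \<Rightarrow> nat \<Rightarrow> nat \<Rightarrow> 'v" where
  "coset_matrix G m rep \<phi> =
     (\<lambda>i j. if i < m \<and> j < m then \<phi> (rep i \<otimes>\<^bsub>G\<^esub> inv\<^bsub>G\<^esub> (rep j)) else 0)"

text \<open>The inverse construction.  As \<open>g\<^sub>0 = 1\<close>, column \<open>0\<close> of \<open>[\<phi>(g\<^sub>i g\<^sub>j\<^sup>-\<^sup>1)]\<close> holds the values of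
  \<open>\<phi>\<close> at the representatives, and the action of \<open>H\<close> determines \<open>\<phi>\<close> on the rest of each coset.\<close>

definition coset_function ::
  "('g, 'b) monoid_scheme \<Rightarrow> 'g set \<Rightarrow> nat \<Rightarrow> (nat \<Rightarrow> 'g) \<Rightarrow> ('g \<Rightarrow> 'v \<Rightarrow> 'v)
     \<Rightarrow> (nat \<Rightarrow> nat \<Rightarrow> 'v) \<Rightarrow> 'g \<Rightarrow> 'v::zero" where
  "coset_function G H m rep act M = (\<lambda>g. if g \<in> carrier G
     then act (inv\<^bsub>G\<^esub> (H_part G H m rep g)) (M (coset_index G H m rep g) 0) else 0)"

text \<open>A finite group with a central subgroup and representatives of its cosets.\<close>

locale central_cosets = group G for G :: "('g, 'b) monoid_scheme" (structure) +
  fixes H :: "'g set" and m :: nat and rep :: "nat \<Rightarrow> 'g"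
  assumes finite_carrier: "finite (carrier G)"
    and subgroup_H: "subgroup H G"
    and H_central: "H \<subseteq> group_center G"
    and reps: "coset_reps G H m rep"
begin

sublocale H: subgroup H G by (rule subgroup_H)

abbreviation "idx \<equiv> coset_index G H m rep"
abbreviation "hpt \<equiv> H_part G H m rep"

lemma H_carrier [simp]: "h \<in> H \<Longrightarrow> h \<in> carrier G"
  using H.subset by blast

lemma H_commute: "h \<in> H \<Longrightarrow> g \<in> carrier G \<Longrightarrow> h \<otimes> g = g \<otimes> h"
  using H_central by (auto simp: group_center_def)

lemma finite_H: "finite H"
  using finite_carrier H.subset by (rule finite_subset [rotated])

lemma card_H_pos: "0 < card H"
  using finite_H H.one_closed unfolding card_gt_0_iff by blast

lemma rep_carrier [simp]: "i < m \<Longrightarrow> rep i \<in> carrier G"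
  and rep_0: "rep 0 = \<one>"
  using reps unfolding coset_reps_def Pi_iff by simp_all

lemma ex1_coset:
  assumes "g \<in> carrier G"
  shows "\<exists>!k. k < m \<and> g \<in> rep k <# H"
proof -
  have bij: "bij_betw (\<lambda>i. rep i <# H) {..<m} (lcosets H)"
    using reps unfolding coset_reps_def by blast
  have g: "g \<in> g <# H" by (rule lcos_self [OF assms subgroup_H])
  have lcosets: "x <# H \<in> lcosets H" if "x \<in> carrier G" for x
    unfolding LCOSETS_def by (rule UN_I [OF that singletonI])
  from lcosets [OF assms] have "g <# H \<in> (\<lambda>i. rep i <# H) ` {..<m}"
    unfolding bij_betw_imp_surj_on [OF bij] .
  then obtain k where "k \<in> {..<m}" and k': "g <# H = rep k <# H" by (rule imageE)
  then have k: "k < m" "g \<in> rep k <# H" using g by simp_all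
  show ?thesis
  proof (rule ex1I)
    show "k < m \<and> g \<in> rep k <# H" using k by (rule conjI)
    fix l assume l: "l < m \<and> g \<in> rep l <# H"
    have "rep l <# H = rep k <# H"
    proof (rule ccontr)
      assume "rep l <# H \<noteq> rep k <# H"
      then have "(rep l <# H) \<inter> (rep k <# H) = {}"
        by (rule lcos_disjoint [OF subgroup_H lcosets lcosets, rotated 2])
          (use l k in \<open>simp_all\<close>)
      with l k show False by blast
    qed
    then show "l = k"
      by (rule inj_onD [OF bij_betw_imp_inj_on [OF bij]]) (use l k in simp_all)
  qed
qed

lemma coset_index_less [simp]: "idx g < m" and coset_index_mem: "g \<in> rep (idx g) <# H"
  if "g \<in> carrier G"
  unfolding coset_index_def
  using theI' [OF ex1_coset [OF that]] by (rule conjunct1, rule conjunct2)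

lemma m_pos: "0 < m"
  using coset_index_less [OF one_closed] by (rule le_less_trans [OF le0])

lemma H_part_in [simp]: "hpt g \<in> H" and rep_H_part: "rep (idx g) \<otimes> hpt g = g"
  if "g \<in> carrier G"
proof -
  define r where "r = rep (idx g)"
  have r: "r \<in> carrier G" using that by (simp add: r_def)
  have "g \<in> r <# H" unfolding r_def using that by (rule coset_index_mem)
  then obtain h where h: "h \<in> H" "g = r \<otimes> h"
    unfolding l_coset_def by (elim UN_E singletonE)
  have "hpt g = inv r \<otimes> g" by (simp add: H_part_def r_def)
  also have "\<dots> = h" unfolding h(2) using h(1) r by (simp flip: m_assoc)
  finally have "hpt g = h" .
  then show "hpt g \<in> H" "rep (idx g) \<otimes> hpt g = g"
    using h(1) by (simp_all flip: r_def h(2))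
qed

lemma coset_index_rep [simp]: "idx (rep i \<otimes> h) = i" and H_part_rep [simp]: "hpt (rep i \<otimes> h) = h"
  if "i < m" "h \<in> H"
proof -
  have *: "rep i \<otimes> h \<in> carrier G" using that by simp
  have "rep i \<otimes> h \<in> rep i <# H" using that by (auto simp: l_coset_def)
  then show **: "idx (rep i \<otimes> h) = i"
    unfolding coset_index_def using that by (intro the1_equality [OF ex1_coset [OF *]] conjI)
  show "hpt (rep i \<otimes> h) = h"
    unfolding H_part_def ** using that m_assoc [of "inv (rep i)" "rep i" h, symmetric] by simp
qed

lemma coset_index_rep' [simp]: "idx (rep i) = i" and H_part_rep' [simp]: "hpt (rep i) = \<one>"
  if "i < m"
  using coset_index_rep [OF that H.one_closed] H_part_rep [OF that H.one_closed] that by simp_all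

lemma coset_index_mult [simp]: "idx (g \<otimes> h) = idx g"
  and H_part_mult [simp]: "hpt (g \<otimes> h) = hpt g \<otimes> h"
  if "g \<in> carrier G" "h \<in> H"
proof -
  have "rep (idx g) \<otimes> (hpt g \<otimes> h) = (rep (idx g) \<otimes> hpt g) \<otimes> h"
    using that by (simp add: m_assoc)
  also have "\<dots> = g \<otimes> h" using that by (simp add: rep_H_part)
  finally have eq: "g \<otimes> h = rep (idx g) \<otimes> (hpt g \<otimes> h)" ..
  show "idx (g \<otimes> h) = idx g" "hpt (g \<otimes> h) = hpt g \<otimes> h"
    using that by (subst eq, simp del: m_assoc)+
qed

lemma sum_cosets: "(\<Sum>g\<in>carrier G. f g) = (\<Sum>a<m. \<Sum>h\<in>H. f (rep a \<otimes> h))"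
proof -
  have "bij_betw (\<lambda>(a, h). rep a \<otimes> h) ({..<m} \<times> H) (carrier G)"
    by (rule bij_betw_byWitness [where f' = "\<lambda>g. (idx g, hpt g)"])
      (auto simp: rep_H_part simp del: coset_index_mult H_part_mult)
  from sum.reindex_bij_betw [OF this, of f] show ?thesis
    by (simp add: sum.cartesian_product case_prod_unfold)
qed

lemma average_cosets:
  fixes f :: "'g \<Rightarrow> 'v::real_vector"
  assumes "\<And>g h. g \<in> carrier G \<Longrightarrow> h \<in> H \<Longrightarrow> f (g \<otimes> h) = f g"
  shows "(1 / real (card H)) *\<^sub>R (\<Sum>g\<in>carrier G. f g) = (\<Sum>a<m. f (rep a))"
  using assms card_H_pos by (simp add: sum_cosets sum_constant_scaleR flip: scaleR_right.sum)

text \<open>The substitution \<open>k = g l\<^sup>-\<^sup>1\<close> turns the convolution into a sum over \<open>l\<close> whose terms, by the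
  invariance assumed of \<open>F\<close>, are constant on the cosets of \<open>H\<close>.\<close>

lemma average_convolution:
  fixes F :: "'g \<Rightarrow> 'g \<Rightarrow> 'v::real_vector"
  assumes inv: "\<And>k l h. k \<in> carrier G \<Longrightarrow> l \<in> carrier G \<Longrightarrow> h \<in> H
      \<Longrightarrow> F (k \<otimes> inv h) (l \<otimes> h) = F k l"
    and g: "g \<in> carrier G"
  shows "(1 / real (card H)) *\<^sub>R (\<Sum>k\<in>carrier G. F k (inv k \<otimes> g))
       = (\<Sum>a<m. F (g \<otimes> inv (rep a)) (rep a))"
proof -
  have "(\<Sum>k\<in>carrier G. F k (inv k \<otimes> g)) = (\<Sum>l\<in>carrier G. F (g \<otimes> inv l) l)"
    by (rule sum.reindex_bij_witness [where i = "\<lambda>l. g \<otimes> inv l" and j = "\<lambda>k. inv k \<otimes> g"])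
      (use g in \<open>simp_all add: inv_mult_group m_assoc, simp_all flip: m_assoc\<close>)
  moreover have "F (g \<otimes> inv (l \<otimes> h)) (l \<otimes> h) = F (g \<otimes> inv l) l"
    if "l \<in> carrier G" "h \<in> H" for l h
  proof -
    have "g \<otimes> inv (l \<otimes> h) = (g \<otimes> inv l) \<otimes> inv h"
      using that g H_commute [of "inv h" "inv l"] by (simp add: inv_mult_group m_assoc)
    then show ?thesis using inv that g by simp
  qed
  ultimately show ?thesis by (simp add: average_cosets)
qed

end

text \<open>An action of \<open>H\<close> on a set \<open>S\<close>; for such an action \<^const>\<open>coset_matrix\<close> and
  \<^const>\<open>coset_function\<close> will be mutually inverse bijections between the induced functions and the
  matrix form.\<close>

locale central_action = central_cosets G H m rep
  for G :: "('g, 'b) monoid_scheme" (structure) and H m rep +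
  fixes act :: "'g \<Rightarrow> 'v \<Rightarrow> 'v::ab_group_add" and S :: "'v set"
  assumes act_closed [simp]: "h \<in> H \<Longrightarrow> x \<in> S \<Longrightarrow> act h x \<in> S"
    and act_one [simp]: "x \<in> S \<Longrightarrow> act \<one> x = x"
    and act_mult: "h \<in> H \<Longrightarrow> k \<in> H \<Longrightarrow> x \<in> S \<Longrightarrow> act (h \<otimes> k) x = act h (act k x)"
begin

abbreviation "MF \<equiv> matrix_form G H m rep act S"
abbreviation "IND \<equiv> induced G H act S"
abbreviation "cmat \<equiv> coset_matrix G m rep"
abbreviation "cfun \<equiv> coset_function G H m rep act"

text \<open>The parameters \<open>x\<^sub>k\<close> of an element of the matrix form are its entries in column \<open>0\<close>.\<close>

lemma matrix_form_iff:
  "M \<in> MF \<longleftrightarrow> M \<in> mats m S \<and> (\<forall>i<m. \<forall>j<m.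
     M i j = act (inv (h_elem G H m rep i j)) (M (r_index G H m rep i j) 0))"
proof
  assume "M \<in> MF"
  then obtain x where x: "\<And>k. k < m \<Longrightarrow> x k \<in> S" and
    M: "M = (\<lambda>i j. if i < m \<and> j < m
         then act (inv (h_elem G H m rep i j)) (x (r_index G H m rep i j)) else 0)"
    unfolding matrix_form_def by blast
  have "M i 0 = x i" if "i < m" for i
    using that m_pos x by (simp add: M h_elem_def r_index_def rep_0)
  moreover have "M i j = act (inv (h_elem G H m rep i j)) (x (r_index G H m rep i j))"
    "act (inv (h_elem G H m rep i j)) (x (r_index G H m rep i j)) \<in> S"
    if "i < m" "j < m" for i j
    using that x by (simp_all add: M h_elem_def r_index_def)
  moreover have "M i j = 0" if "\<not> (i < m \<and> j < m)" for i j
    unfolding M if_not_P [OF that] ..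
  moreover have "r_index G H m rep i j < m" if "i < m" "j < m" for i j
    using that by (simp add: r_index_def)
  ultimately show "M \<in> mats m S \<and> (\<forall>i<m. \<forall>j<m.
     M i j = act (inv (h_elem G H m rep i j)) (M (r_index G H m rep i j) 0))"
    by (simp add: mats_def)
next
  assume *: "M \<in> mats m S \<and> (\<forall>i<m. \<forall>j<m.
     M i j = act (inv (h_elem G H m rep i j)) (M (r_index G H m rep i j) 0))"
  have "M = (\<lambda>i j. if i < m \<and> j < m
      then act (inv (h_elem G H m rep i j)) (M (r_index G H m rep i j) 0) else 0)"
  proof (intro ext)
    fix i j
    show "M i j = (if i < m \<and> j < m
      then act (inv (h_elem G H m rep i j)) (M (r_index G H m rep i j) 0) else 0)"
    proof (cases "i < m \<and> j < m")
      case True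
      show ?thesis unfolding if_P [OF True] using * True by blast
    next
      case False
      show ?thesis unfolding if_not_P [OF False] using * False unfolding mats_def by blast
    qed
  qed
  moreover have "\<forall>k<m. M k 0 \<in> S" using conjunct1 [OF *] m_pos by (simp add: mats_def)
  ultimately show "M \<in> MF"
    unfolding matrix_form_def by (intro CollectI exI [of _ "\<lambda>k. M k 0"] conjI)
qed

lemma matrix_form_subset: "MF \<subseteq> mats m S"
  using matrix_form_iff by blast

lemma inducedD:
  assumes "\<phi> \<in> IND"
  shows "g \<in> carrier G \<Longrightarrow> \<phi> g \<in> S" "g \<notin> carrier G \<Longrightarrow> \<phi> g = 0"
    "g \<in> carrier G \<Longrightarrow> h \<in> H \<Longrightarrow> \<phi> (g \<otimes> h) = act (inv h) (\<phi> g)"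
  using assms by (auto simp: induced_def)

lemma coset_function_in_induced:
  assumes "M \<in> mats m S"
  shows "cfun M \<in> IND"
proof -
  have M: "M i 0 \<in> S" if "i < m" for i using assms that m_pos by (simp add: mats_def)
  have "act (inv (hpt g \<otimes> h)) (M (idx g) 0) = act (inv h) (act (inv (hpt g)) (M (idx g) 0))"
    if "g \<in> carrier G" "h \<in> H" for g h
    using that M by (simp add: inv_mult_group act_mult)
  then show ?thesis using M by (auto simp: induced_def coset_function_def)
qed

lemma coset_function_matrix: "cfun (cmat \<phi>) = \<phi>" if "\<phi> \<in> IND"
proof
  fix g
  show "cfun (cmat \<phi>) g = \<phi> g"
  proof (cases "g \<in> carrier G")
    case True
    then show ?thesis
      using inducedD(3) [OF that, of "rep (idx g)" "hpt g"] m_pos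
      by (simp add: coset_function_def coset_matrix_def rep_0 rep_H_part)
  qed (use inducedD(2) [OF that] in \<open>simp add: coset_function_def\<close>)
qed

lemma coset_matrix_in_matrix_form:
  assumes "\<phi> \<in> IND"
  shows "cmat \<phi> \<in> MF"
  unfolding matrix_form_iff
proof (intro conjI allI impI)
  show "cmat \<phi> \<in> mats m S"
    using inducedD(1) [OF assms] by (simp add: coset_matrix_def mats_def)
  fix i j assume ij: "i < m" "j < m"
  define g where "g = rep i \<otimes> inv (rep j)"
  have g: "g \<in> carrier G" using ij by (simp add: g_def)
  have "cmat \<phi> i j = \<phi> (rep (idx g) \<otimes> hpt g)"
    using ij g by (simp add: coset_matrix_def rep_H_part) (simp add: g_def)
  also have "\<dots> = act (inv (hpt g)) (\<phi> (rep (idx g)))"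
    using g by (simp add: inducedD(3) [OF assms])
  also have "\<phi> (rep (idx g)) = cmat \<phi> (idx g) 0"
    using g m_pos by (simp add: coset_matrix_def rep_0)
  finally show "cmat \<phi> i j = act (inv (h_elem G H m rep i j)) (cmat \<phi> (r_index G H m rep i j) 0)"
    by (simp add: g_def h_elem_def r_index_def)
qed

lemma coset_function_entry:
  assumes "M \<in> MF" "i < m" "j < m"
  shows "cfun M (rep i \<otimes> inv (rep j)) = M i j"
proof -
  have "M i j = act (inv (h_elem G H m rep i j)) (M (r_index G H m rep i j) 0)"
    using assms unfolding matrix_form_iff by blast
  then show ?thesis using assms(2,3) by (simp add: coset_function_def h_elem_def r_index_def)
qed

lemma coset_matrix_function: "cmat (cfun M) = M" if "M \<in> MF"
proof (intro ext)
  fix i j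
  show "cmat (cfun M) i j = M i j"
    using that coset_function_entry [OF that] matrix_form_subset
    by (auto simp: coset_matrix_def mats_def)
qed

lemma coset_function_in_induced': "M \<in> MF \<Longrightarrow> cfun M \<in> IND"
  using coset_function_in_induced matrix_form_subset by blast

lemma bij_coset_function: "bij_betw cfun MF IND"
  by (rule bij_betw_byWitness [where f' = cmat])
    (auto simp: coset_function_matrix coset_matrix_function coset_matrix_in_matrix_form
      coset_function_in_induced')

lemma coset_function_add:
  assumes "\<And>h x y. h \<in> H \<Longrightarrow> x \<in> S \<Longrightarrow> y \<in> S \<Longrightarrow> act h (x + y) = act h x + act h y"
    and "M \<in> MF" "N \<in> MF"
  shows "cfun (M + N) = cfun M + cfun N"
proof
  fix g
  have "M i 0 \<in> S" "N i 0 \<in> S" if "i < m" for i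
    using assms(2,3) matrix_form_subset m_pos that by (auto simp: mats_def)
  then show "cfun (M + N) g = (cfun M + cfun N) g"
    by (simp add: coset_function_def assms(1))
qed

lemma coset_function_scale:
  assumes "\<And>h x. h \<in> H \<Longrightarrow> x \<in> S \<Longrightarrow> act h (s x) = s (act h x)" and "s 0 = 0"
    and "M \<in> MF"
  shows "cfun (\<lambda>i j. s (M i j)) = (\<lambda>g. s (cfun M g))"
proof
  fix g
  have "M i 0 \<in> S" if "i < m" for i
    using assms(3) matrix_form_subset m_pos that by (auto simp: mats_def)
  then show "cfun (\<lambda>i j. s (M i j)) g = s (cfun M g)"
    by (simp add: coset_function_def assms(1,2))
qed

end

section \<open>Convolution operators as matrices of operators\<close>

lemma sum_fun_apply: "sum f A x = (\<Sum>i\<in>A. f i x)"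
  by (induction A rule: infinite_finite_induct) simp_all

lemma sum_blocks:
  fixes f :: "nat \<Rightarrow> nat \<Rightarrow> 'a::comm_monoid_add"
  assumes "0 < m"
  shows "(\<Sum>p<n * m. f (p div m) (p mod m)) = (\<Sum>i<n. \<Sum>a<m. f i a)"
proof -
  have "i * m + a < n * m" if "i < n" "a < m" for i a
  proof -
    have "i * m + a < Suc i * m" using that by simp
    also have "\<dots> \<le> n * m" using that by (intro mult_le_mono1) simp
    finally show ?thesis .
  qed
  then have "(\<Sum>p<n * m. f (p div m) (p mod m)) = (\<Sum>(i, a)\<in>{..<n} \<times> {..<m}. f i a)"
    using assms
    by (intro sum.reindex_bij_witness
          [where i = "\<lambda>(i, a). i * m + a" and j = "\<lambda>p. (p div m, p mod m)"])
      (auto simp: less_mult_imp_div_less)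
  then show ?thesis by (simp add: sum.cartesian_product)
qed

text \<open>A unitary representation of the central subgroup \<open>H\<close> on a Hilbert space.\<close>

locale central_rep = central_cosets G H m rep + hilbert_space sc ip
  for G :: "('g, 'b) monoid_scheme" (structure) and H m rep
    and sc :: "'k::real_or_complex \<Rightarrow> 'h::banach \<Rightarrow> 'h" and ip +
  fixes \<theta> :: "'g \<Rightarrow> 'h \<Rightarrow> 'h"
  assumes unitary: "unitary_rep G H sc ip \<theta>"
begin

lemma theta_bounded_ops: "h \<in> H \<Longrightarrow> \<theta> h \<in> elts (bounded_ops sc ip)"
  and ip_theta: "h \<in> H \<Longrightarrow> ip (\<theta> h x) (\<theta> h y) = ip x y"
  and theta_one [simp]: "\<theta> \<one> x = x"
  and theta_mult: "h \<in> H \<Longrightarrow> k \<in> H \<Longrightarrow> \<theta> (h \<otimes> k) x = \<theta> h (\<theta> k x)"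
  using unitary by (simp_all add: unitary_rep_def)

lemma bounded_linear_theta: "h \<in> H \<Longrightarrow> bounded_linear (\<theta> h)"
  and theta_scale: "h \<in> H \<Longrightarrow> \<theta> h (sc c x) = sc c (\<theta> h x)"
  using theta_bounded_ops by (simp_all add: bounded_ops_def)

lemma theta_add: "h \<in> H \<Longrightarrow> \<theta> h (x + y) = \<theta> h x + \<theta> h y"
  by (rule Real_Vector_Spaces.linear_add, rule bounded_linear.linear, rule bounded_linear_theta)

lemma theta_zero: "h \<in> H \<Longrightarrow> \<theta> h 0 = 0"
  by (rule Real_Vector_Spaces.linear_0, rule bounded_linear.linear, rule bounded_linear_theta)

lemma theta_sum: "h \<in> H \<Longrightarrow> \<theta> h (sum f I) = (\<Sum>i\<in>I. \<theta> h (f i))"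
  by (rule Real_Vector_Spaces.linear_sum, rule bounded_linear.linear, rule bounded_linear_theta)

lemma norm_theta: "h \<in> H \<Longrightarrow> norm (\<theta> h x) = norm x"
  by (intro norm_eq_of_ip_eq ip_theta)

lemma theta_inv: "h \<in> H \<Longrightarrow> \<theta> h (\<theta> (inv h) x) = x" "h \<in> H \<Longrightarrow> \<theta> (inv h) (\<theta> h x) = x"
  by (simp_all flip: theta_mult)

sublocale HG: central_action G H m rep \<theta> UNIV
  by unfold_locales (simp_all add: theta_mult)

text \<open>The algebra \<open>\<C>\<^sub>G\<close> induced from the full commutant.  All convolution operators considered below
  have their symbol in it.\<close>

abbreviation "CG \<equiv> induced G H (\<lambda>h T. \<theta> h \<circ> T) (commutant sc ip H \<theta>)"

lemma CGD:
  assumes "\<Psi> \<in> CG" "g \<in> carrier G"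
  shows CG_bounded: "bounded_linear (\<Psi> g)"
    and CG_theta: "h \<in> H \<Longrightarrow> \<Psi> g (\<theta> h x) = \<theta> h (\<Psi> g x)"
    and CG_mult: "h \<in> H \<Longrightarrow> \<Psi> (g \<otimes> h) x = \<theta> (inv h) (\<Psi> g x)"
proof -
  have "\<Psi> g \<in> commutant sc ip H \<theta>" using assms by (simp add: induced_def)
  then show "bounded_linear (\<Psi> g)" "h \<in> H \<Longrightarrow> \<Psi> g (\<theta> h x) = \<theta> h (\<Psi> g x)"
    by (auto simp: commutant_def bounded_ops_def fun_eq_iff)
  show "h \<in> H \<Longrightarrow> \<Psi> (g \<otimes> h) x = \<theta> (inv h) (\<Psi> g x)"
    using assms by (simp add: induced_def)
qed

text \<open>In terms of the values at the representatives, \<open>\<I>(\<Psi>)\<close> is multiplication by the matrix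
  \<open>[\<Psi>(g\<^sub>i g\<^sub>j\<^sup>-\<^sup>1)]\<close>.\<close>

lemma conv_op_eq:
  assumes "\<Psi> \<in> CG" "\<xi> \<in> HG.IND" "g \<in> carrier G"
  shows "conv_op G H \<Psi> \<xi> g = (\<Sum>a<m. \<Psi> (g \<otimes> inv (rep a)) (\<xi> (rep a)))"
proof -
  have "\<Psi> (k \<otimes> inv h) (\<xi> (l \<otimes> h)) = \<Psi> k (\<xi> l)"
    if "k \<in> carrier G" "l \<in> carrier G" "h \<in> H" for k l h
    using that by (simp add: CGD [OF assms(1)] HG.inducedD [OF assms(2)] theta_inv)
  from average_convolution [of "\<lambda>k l. \<Psi> k (\<xi> l)", OF this assms(3)] assms(3)
  show ?thesis by (simp add: conv_op_def)
qed

lemma mult_H_swap: "g \<in> carrier G \<Longrightarrow> k \<in> carrier G \<Longrightarrow> h \<in> H \<Longrightarrow> g \<otimes> h \<otimes> k = g \<otimes> k \<otimes> h"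
  using H_commute [of h k] by (simp add: m_assoc)

lemma conv_op_in_induced:
  assumes "\<Psi> \<in> CG" "\<xi> \<in> HG.IND"
  shows "conv_op G H \<Psi> \<xi> \<in> HG.IND"
proof -
  have "conv_op G H \<Psi> \<xi> (g \<otimes> h) = \<theta> (inv h) (conv_op G H \<Psi> \<xi> g)"
    if "g \<in> carrier G" "h \<in> H" for g h
  proof -
    have "\<Psi> (g \<otimes> h \<otimes> inv (rep a)) x = \<theta> (inv h) (\<Psi> (g \<otimes> inv (rep a)) x)" if "a < m" for a x
      using that \<open>g \<in> carrier G\<close> \<open>h \<in> H\<close>
      by (simp add: mult_H_swap [of g "inv (rep a)" h] CG_mult [OF assms(1)])
    then show ?thesis using that by (simp add: conv_op_eq [OF assms] theta_sum)
  qed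
  then show ?thesis by (simp add: induced_def) (simp add: conv_op_def)
qed

lemma sum_in_induced:
  assumes "\<And>j. j \<in> J \<Longrightarrow> \<xi> j \<in> HG.IND"
  shows "sum \<xi> J \<in> HG.IND"
  using assms by (auto simp: induced_def sum_fun_apply theta_sum)

lemma sum_norm_induced:
  assumes "\<xi> \<in> HG.IND"
  shows "(\<Sum>g\<in>carrier G. (norm (\<xi> g))\<^sup>2) = real (card H) * (\<Sum>a<m. (norm (\<xi> (rep a)))\<^sup>2)"
proof -
  have "(1 / real (card H)) *\<^sub>R (\<Sum>g\<in>carrier G. (norm (\<xi> g))\<^sup>2) = (\<Sum>a<m. (norm (\<xi> (rep a)))\<^sup>2)"
    by (rule average_cosets) (simp add: HG.inducedD [OF assms] norm_theta)
  then show ?thesis using card_H_pos by (simp add: field_simps)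
qed

text \<open>The map \<open>\<xi> \<mapsto> (|H|\<^bsup>1/2\<^esup> \<xi>(g\<^sub>a))\<^sub>a\<close> is an isometry from the induced Hilbert space to the
  \<open>m\<close>-fold sum; here for \<open>n\<close>-tuples, with position \<open>jm + a\<close> for component \<open>j\<close> and representative
  \<open>a\<close>.\<close>

lemma L2_induced:
  assumes "\<And>j. j < n \<Longrightarrow> \<xi> j \<in> HG.IND"
    and "\<And>p. p < n * m \<Longrightarrow> \<eta> p = sqrt (card H) *\<^sub>R \<xi> (p div m) (rep (p mod m))"
  shows "L2_set (\<lambda>j. L2_set (\<lambda>g. norm (\<xi> j g)) (carrier G)) {..<n}
       = L2_set (\<lambda>p. norm (\<eta> p)) {..<n * m}"
proof -
  have "(\<Sum>j<n. (L2_set (\<lambda>g. norm (\<xi> j g)) (carrier G))\<^sup>2)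
      = (\<Sum>j<n. \<Sum>a<m. real (card H) * (norm (\<xi> j (rep a)))\<^sup>2)"
    using assms(1) by (simp add: L2_set_def sum_nonneg sum_norm_induced sum_distrib_left)
  also have "\<dots> = (\<Sum>p<n * m. real (card H) * (norm (\<xi> (p div m) (rep (p mod m))))\<^sup>2)"
    by (rule sum_blocks [OF m_pos, symmetric])
  also have "\<dots> = (\<Sum>p<n * m. (norm (\<eta> p))\<^sup>2)"
    by (rule sum.cong) (simp_all add: assms(2) power_mult_distrib)
  finally show ?thesis by (simp add: L2_set_def)
qed

text \<open>Since this isometry is surjective and intertwines the two operators, both operator norms are
  suprema of the same set of real numbers.\<close>

lemma induced_opnorm_eq:
  assumes \<Psi>: "\<And>i j. i < n \<Longrightarrow> j < n \<Longrightarrow> \<Psi> i j \<in> CG"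
  shows "induced_opnorm G H \<theta> n (\<lambda>i j. conv_op G H (\<Psi> i j))
       = mat_opnorm UNIV norm (n * m) (flatten n m (\<lambda>i j. coset_matrix G m rep (\<Psi> i j)))"
proof -
  define c where "c = sqrt (card H)"
  have c: "c > 0" using card_H_pos by (simp add: c_def)
  define T where "T = flatten n m (\<lambda>i j. coset_matrix G m rep (\<Psi> i j))"
  define S where "S = {\<xi>. (\<forall>j<n. \<xi> j \<in> HG.IND)
    \<and> L2_set (\<lambda>j. L2_set (\<lambda>g. norm (\<xi> j g)) (carrier G)) {..<n} \<le> 1}"
  define S' where "S' = {\<eta> :: nat \<Rightarrow> 'h. (\<forall>j<n * m. \<eta> j \<in> UNIV)
    \<and> L2_set (\<lambda>j. norm (\<eta> j)) {..<n * m} \<le> 1}"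
  define V where "V = (\<lambda>\<xi>. L2_set (\<lambda>i. L2_set
    (\<lambda>g. norm ((\<Sum>j<n. conv_op G H (\<Psi> i j) (\<xi> j)) g)) (carrier G)) {..<n})"
  define V' where "V' = (\<lambda>\<eta>. L2_set (\<lambda>i. norm (\<Sum>j<n * m. T i j (\<eta> j))) {..<n * m})"
  have values_eq: "V \<xi> = V' \<eta>"
    if \<xi>: "\<And>j. j < n \<Longrightarrow> \<xi> j \<in> HG.IND"
      and \<eta>: "\<And>p. p < n * m \<Longrightarrow> \<eta> p = c *\<^sub>R \<xi> (p div m) (rep (p mod m))" for \<xi> \<eta>
    unfolding V_def V'_def
  proof (rule L2_induced)
    show "(\<Sum>j<n. conv_op G H (\<Psi> i j) (\<xi> j)) \<in> HG.IND" if "i < n" for i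
      using that by (intro sum_in_induced conv_op_in_induced \<Psi> \<xi>) simp_all
    fix p assume p: "p < n * m"
    define i a where "i = p div m" and "a = p mod m"
    have ia: "i < n" "a < m"
      using p m_pos by (simp_all add: i_def a_def less_mult_imp_div_less)
    have "(\<Sum>q<n * m. T p q (\<eta> q))
        = (\<Sum>q<n * m. \<Psi> i (q div m) (rep a \<otimes> inv (rep (q mod m)))
                         (c *\<^sub>R \<xi> (q div m) (rep (q mod m))))"
      using p m_pos
      by (intro sum.cong) (simp_all add: T_def flatten_def coset_matrix_def \<eta> i_def a_def)
    also have "\<dots> = (\<Sum>j<n. \<Sum>b<m. \<Psi> i j (rep a \<otimes> inv (rep b)) (c *\<^sub>R \<xi> j (rep b)))"
      by (rule sum_blocks [OF m_pos])
    also have "\<dots> = (\<Sum>j<n. c *\<^sub>R conv_op G H (\<Psi> i j) (\<xi> j) (rep a))"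
    proof (rule sum.cong)
      fix j assume "j \<in> {..<n}"
      then have "j < n" by simp
      have "\<Psi> i j (rep a \<otimes> inv (rep b)) (c *\<^sub>R x) = c *\<^sub>R \<Psi> i j (rep a \<otimes> inv (rep b)) x"
        if "b < m" for b x
        using CG_bounded [OF \<Psi> [OF ia(1) \<open>j < n\<close>]] ia that
        by (simp add: bounded_linear.linear Real_Vector_Spaces.linear_scale)
      then show "(\<Sum>b<m. \<Psi> i j (rep a \<otimes> inv (rep b)) (c *\<^sub>R \<xi> j (rep b)))
          = c *\<^sub>R conv_op G H (\<Psi> i j) (\<xi> j) (rep a)"
        using ia \<open>j < n\<close> by (simp add: conv_op_eq \<Psi> \<xi> scaleR_sum_right)
    qed simp
    also have "\<dots> = c *\<^sub>R (\<Sum>j<n. conv_op G H (\<Psi> i j) (\<xi> j)) (rep a)"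
      by (simp add: sum_fun_apply scaleR_sum_right)
    finally show "(\<Sum>q<n * m. T p q (\<eta> q))
        = sqrt (card H) *\<^sub>R (\<Sum>j<n. conv_op G H (\<Psi> (p div m) j) (\<xi> j)) (rep (p mod m))"
      by (simp add: i_def a_def c_def)
  qed
  have "V ` S = V' ` S'"
  proof (intro equalityI image_subsetI)
    fix \<xi> assume \<xi>: "\<xi> \<in> S"
    define \<eta> where "\<eta> = (\<lambda>p. c *\<^sub>R \<xi> (p div m) (rep (p mod m)))"
    have "V \<xi> = V' \<eta>" using \<xi> by (intro values_eq) (simp_all add: S_def \<eta>_def)
    moreover have "\<eta> \<in> S'"
      using L2_induced [of n \<xi> \<eta>] \<xi> by (simp add: S_def S'_def \<eta>_def c_def)
    ultimately show "V \<xi> \<in> V' ` S'" by simp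
  next
    fix \<eta> assume \<eta>: "\<eta> \<in> S'"
    \<comment> \<open>Only column \<open>0\<close> of these matrices enters \<open>\<xi>\<close>, the element with prescribed values at the representatives.\<close>
    define M where "M = (\<lambda>j a b. if a < m \<and> b < m then (1 / c) *\<^sub>R \<eta> (j * m + a) else 0)"
    define \<xi> where "\<xi> = (\<lambda>j. HG.cfun (M j))"
    have \<xi>: "\<xi> j \<in> HG.IND" for j
      unfolding \<xi>_def by (rule HG.coset_function_in_induced) (simp add: M_def mats_def)
    have \<eta>\<xi>: "\<eta> p = c *\<^sub>R \<xi> (p div m) (rep (p mod m))" for p
      using m_pos c by (simp add: \<xi>_def M_def coset_function_def)
    have "V \<xi> = V' \<eta>" using \<xi> \<eta>\<xi> by (intro values_eq) simp_all
    moreover have "\<xi> \<in> S"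
      using L2_induced [of n \<xi> \<eta>] \<xi> \<eta>\<xi> \<eta> by (simp add: S_def S'_def c_def)
    ultimately show "V' \<eta> \<in> V ` S" by (metis image_eqI)
  qed
  then show ?thesis
    by (simp add: induced_opnorm_def mat_opnorm_def V_def V'_def S_def S'_def T_def)
qed

end

section \<open>Norms of matrices of operators and of their entries\<close>

lemma mat_algebra_simps [simp]:
  "elts (mat_algebra m B) = mats m (elts B)"
  "smul (mat_algebra m B) = (\<lambda>c x i j. smul B c (x i j))"
  "mnorm (mat_algebra m B) = (\<lambda>n Y. mnorm B (n * m) (flatten n m Y))"
  "amult (mat_algebra m B) =
     (\<lambda>x y i j. if i < m \<and> j < m then \<Sum>l<m. amult B (x i l) (y l j) else 0)"
  "astar (mat_algebra m B) = (\<lambda>x i j. if i < m \<and> j < m then astar B (x j i) else 0)"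
  by (simp_all add: mat_algebra_def mat_space_def op_space.extend_def op_algebra.fields_def)

lemma L2_set_single:
  fixes n :: nat
  assumes "j0 < n" "0 \<le> c"
  shows "L2_set (\<lambda>j. if j = j0 then c else 0) {..<n} = c"
proof -
  have "(\<Sum>j<n. (if j = j0 then c else 0)\<^sup>2) = (\<Sum>j<n. if j = j0 then c\<^sup>2 else 0)"
    by (rule sum.cong) auto
  also have "\<dots> = c\<^sup>2" using assms(1) by (subst sum.delta) simp_all
  finally show ?thesis using assms(2) by (simp add: L2_set_def)
qed

lemma bdd_above_mat_opnorm:
  fixes T :: "nat \<Rightarrow> nat \<Rightarrow> 'h::real_normed_vector \<Rightarrow> 'h"
  assumes "\<And>i j. i < n \<Longrightarrow> j < n \<Longrightarrow> bounded_linear (T i j)"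
  shows "bdd_above ((\<lambda>\<xi>. L2_set (\<lambda>i. norm (\<Sum>j<n. T i j (\<xi> j))) {..<n})
    ` {\<xi>. (\<forall>j<n. \<xi> j \<in> UNIV) \<and> L2_set (\<lambda>j. norm (\<xi> j)) {..<n} \<le> 1})"
proof (rule bdd_aboveI2)
  fix \<xi> :: "nat \<Rightarrow> 'h"
  assume "\<xi> \<in> {\<xi>. (\<forall>j<n. \<xi> j \<in> UNIV) \<and> L2_set (\<lambda>j. norm (\<xi> j)) {..<n} \<le> 1}"
  then have le1: "norm (\<xi> j) \<le> 1" if "j < n" for j
    using member_le_L2_set [of "{..<n}" j "\<lambda>j. norm (\<xi> j)"] that by simp
  have "norm (T i j (\<xi> j)) \<le> onorm (T i j)" if "i < n" "j < n" for i j
  proof -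
    have "norm (T i j (\<xi> j)) \<le> onorm (T i j) * norm (\<xi> j)"
      using assms that by (intro onorm) simp_all
    also have "\<dots> \<le> onorm (T i j) * 1"
      using assms that by (intro mult_left_mono le1 onorm_pos_le) simp_all
    finally show ?thesis by simp
  qed
  then have "(\<Sum>i<n. norm (\<Sum>j<n. T i j (\<xi> j))) \<le> (\<Sum>i<n. \<Sum>j<n. onorm (T i j))"
    by (intro sum_mono sum_norm_le) simp
  then show "L2_set (\<lambda>i. norm (\<Sum>j<n. T i j (\<xi> j))) {..<n} \<le> (\<Sum>i<n. \<Sum>j<n. onorm (T i j))"
    by (intro order_trans [OF L2_set_le_sum]) simp_all
qed

lemma norm_entry_le_mat_opnorm:
  fixes T :: "nat \<Rightarrow> nat \<Rightarrow> 'h::real_normed_vector \<Rightarrow> 'h"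
  assumes T: "\<And>i j. i < n \<Longrightarrow> j < n \<Longrightarrow> bounded_linear (T i j)"
    and "i0 < n" "j0 < n" "norm v \<le> 1"
  shows "norm (T i0 j0 v) \<le> mat_opnorm UNIV norm n T"
proof -
  define \<xi> where "\<xi> = (\<lambda>j. if j = j0 then v else 0)"
  have "(\<Sum>j<n. T i0 j (\<xi> j)) = (\<Sum>j<n. if j = j0 then T i0 j0 v else 0)"
    using assms(2) T by (intro sum.cong)
      (auto simp: \<xi>_def Real_Vector_Spaces.linear_0 bounded_linear.linear)
  also have "\<dots> = T i0 j0 v" using assms(3) by (subst sum.delta) simp_all
  finally have "norm (T i0 j0 v) = norm (\<Sum>j<n. T i0 j (\<xi> j))" by simp
  also have "\<dots> \<le> L2_set (\<lambda>i. norm (\<Sum>j<n. T i j (\<xi> j))) {..<n}"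
    using assms(2) by (intro member_le_L2_set) simp_all
  also have "\<dots> \<le> mat_opnorm UNIV norm n T"
    unfolding mat_opnorm_def
  proof (rule cSUP_upper [OF _ bdd_above_mat_opnorm [OF T]])
    have "(\<lambda>j. norm (\<xi> j)) = (\<lambda>j. if j = j0 then norm v else 0)" by (auto simp: \<xi>_def)
    then show "\<xi> \<in> {\<xi>. (\<forall>j<n. \<xi> j \<in> UNIV) \<and> L2_set (\<lambda>j. norm (\<xi> j)) {..<n} \<le> 1}"
      using assms(3,4) by (simp add: L2_set_single)
  qed
  finally show ?thesis .
qed

lemma norm_le_elt_norm:
  assumes "bounded_linear T"
  shows "norm (T v) \<le> elt_norm (bounded_ops sc ip) T * norm v"
proof -
  have unit: "norm (T w) \<le> elt_norm (bounded_ops sc ip) T" if "norm w \<le> 1" for w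
    using norm_entry_le_mat_opnorm [of 1 "\<lambda>i j. if i = 0 \<and> j = 0 then T else 0" 0 0 w] assms that
    by (simp add: elt_norm_def bounded_ops_def)
  show ?thesis
  proof (cases "v = 0")
    case True
    then show ?thesis by (simp add: Real_Vector_Spaces.linear_0 bounded_linear.linear assms)
  next
    case False
    define w where "w = (1 / norm v) *\<^sub>R v"
    have v: "v = norm v *\<^sub>R w" and w: "norm w \<le> 1" using False by (simp_all add: w_def)
    have "T (norm v *\<^sub>R w) = norm v *\<^sub>R T w"
      by (rule Real_Vector_Spaces.linear_scale [OF bounded_linear.linear [OF assms]])
    then have "norm (T v) = norm v * norm (T w)" by (simp flip: v)
    also have "\<dots> \<le> norm v * elt_norm (bounded_ops sc ip) T"
      using w by (intro mult_left_mono unit) simp_all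
    finally show ?thesis by (simp add: mult.commute)
  qed
qed

lemma elt_norm_le:
  fixes T :: "'h::banach \<Rightarrow> 'h"
  assumes "\<And>v. norm v \<le> 1 \<Longrightarrow> norm (T v) \<le> c"
  shows "elt_norm (bounded_ops sc ip) T \<le> c"
proof -
  have *: "{..<1} = {0::nat}" by auto
  have "mat_opnorm UNIV norm 1 (\<lambda>i j. if i = 0 \<and> j = 0 then T else 0) \<le> c"
    unfolding mat_opnorm_def *
  proof (rule cSUP_least)
    have "(\<lambda>_. 0) \<in> {\<xi> :: nat \<Rightarrow> 'h. (\<forall>j<1. \<xi> j \<in> UNIV) \<and> L2_set (\<lambda>j. norm (\<xi> j)) {0} \<le> 1}"
      by simp
    then show "{\<xi> :: nat \<Rightarrow> 'h. (\<forall>j<1. \<xi> j \<in> UNIV) \<and> L2_set (\<lambda>j. norm (\<xi> j)) {0} \<le> 1} \<noteq> {}"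
      by (rule ex_in_conv [THEN iffD1, OF exI])
  qed (simp add: assms)
  then show ?thesis by (simp add: elt_norm_def bounded_ops_def)
qed

lemma elt_norm_nonneg: "bounded_linear T \<Longrightarrow> 0 \<le> elt_norm (bounded_ops sc ip) T"
  using norm_entry_le_mat_opnorm [of 1 "\<lambda>i j. if i = 0 \<and> j = 0 then T else 0" 0 0 0]
    Real_Vector_Spaces.linear_0 [OF bounded_linear.linear, of T]
  by (simp add: elt_norm_def bounded_ops_def)

lemma elt_norm_entry_le:
  fixes T :: "nat \<Rightarrow> nat \<Rightarrow> 'h::banach \<Rightarrow> 'h"
  assumes T: "T \<in> mats m (elts (bounded_ops sc ip))" and "i < m" "j < m"
  shows "elt_norm (bounded_ops sc ip) (T i j) \<le> elt_norm (mat_algebra m (bounded_ops sc ip)) T"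
proof -
  have "flatten 1 m (\<lambda>i j. if i = 0 \<and> j = 0 then T else 0) = T"
    using T by (intro ext) (simp add: flatten_def mats_def)
  then have "elt_norm (mat_algebra m (bounded_ops sc ip)) T = mat_opnorm UNIV norm m T"
    by (simp add: elt_norm_def bounded_ops_def)
  moreover have "bounded_linear (T i j)" if "i < m" "j < m" for i j
    using T that by (simp add: mats_def bounded_ops_def)
  ultimately show ?thesis
    using assms(2,3) by (simp, intro elt_norm_le norm_entry_le_mat_opnorm)
qed

section \<open>The matrix form of a C*-algebra\<close>

text \<open>A C*-subalgebra of the commutant of the representation that is also an \<open>H\<close>-submodule.\<close>

locale central_subalgebra = central_rep G H m rep sc ip \<theta>
  for G :: "('g, 'b) monoid_scheme" (structure) and H m rep
    and sc :: "'k::real_or_complex \<Rightarrow> 'h::banach \<Rightarrow> 'h" and ip \<theta> +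
  fixes A :: "('h \<Rightarrow> 'h) set"
  assumes cstar: "cstar_subalgebra ((bounded_ops sc ip)\<lparr>elts := commutant sc ip H \<theta>\<rparr>) A"
    and submodule: "\<forall>h\<in>H. \<forall>T\<in>A. \<theta> h \<circ> T \<in> A"
begin

abbreviation "B \<equiv> bounded_ops sc ip"

lemma module_ops: "module (smul B)"
  by unfold_locales (simp_all add: bounded_ops_def fun_eq_iff scale_right_distrib scale_left_distrib)

lemma module_mats: "module (smul (mat_algebra m B))"
  by unfold_locales (simp_all add: bounded_ops_def fun_eq_iff scale_right_distrib scale_left_distrib)

text \<open>The conjuncts of the definition: containment, subspace, product, adjoint, closedness.\<close>

lemmas cstarD = cstar [unfolded cstar_subalgebra_def, THEN conjunct1]
  cstar [unfolded cstar_subalgebra_def, THEN conjunct2, THEN conjunct1]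
  cstar [unfolded cstar_subalgebra_def, THEN conjunct2, THEN conjunct2, THEN conjunct1]
  cstar [unfolded cstar_subalgebra_def, THEN conjunct2, THEN conjunct2, THEN conjunct2, THEN conjunct1]
  cstar [unfolded cstar_subalgebra_def, THEN conjunct2, THEN conjunct2, THEN conjunct2, THEN conjunct2]

lemma A_commutant: "A \<subseteq> commutant sc ip H \<theta>"
  using cstarD(1) by simp

lemma A_ops: "T \<in> A \<Longrightarrow> T \<in> elts B"
  using A_commutant by (auto simp: commutant_def)

lemma A_subspace: "module.subspace (smul B) A"
  using cstarD(2) by simp

lemma A_zero: "0 \<in> A"
  by (rule module.subspace_0 [OF module_ops A_subspace])

lemma A_add: "S \<in> A \<Longrightarrow> T \<in> A \<Longrightarrow> S + T \<in> A"
  by (rule module.subspace_add [OF module_ops A_subspace])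

lemma A_scale: "T \<in> A \<Longrightarrow> (\<lambda>x. sc c (T x)) \<in> A"
  using module.subspace_scale [OF module_ops A_subspace, of T c] by (simp add: bounded_ops_def)

lemma A_comp: "S \<in> A \<Longrightarrow> T \<in> A \<Longrightarrow> S \<circ> T \<in> A"
  using cstarD(3) by (simp add: bounded_ops_def)

lemma A_adjoint: "T \<in> A \<Longrightarrow> adjoint_op ip T \<in> A"
  using cstarD(4) by (simp add: bounded_ops_def)

lemma A_closed:
  assumes "\<And>n. f n \<in> A" "T \<in> commutant sc ip H \<theta>" "(\<lambda>n. elt_norm B (f n - T)) \<longlonglongrightarrow> 0"
  shows "T \<in> A"
proof -
  have "elt_norm (B\<lparr>elts := commutant sc ip H \<theta>\<rparr>) = elt_norm B"
    by (simp add: elt_norm_def fun_eq_iff)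
  moreover have "T \<in> elts (B\<lparr>elts := commutant sc ip H \<theta>\<rparr>)" using assms(2) by simp
  ultimately show ?thesis
    by (intro cstarD(5) [rule_format, of T f] conjI allI) (simp_all only: assms)
qed

lemma A_sum: "(\<And>i. i \<in> I \<Longrightarrow> f i \<in> A) \<Longrightarrow> sum f I \<in> A"
  by (induction I rule: infinite_finite_induct) (simp_all add: A_zero A_add)

sublocale A: central_action G H m rep "\<lambda>h T. \<theta> h \<circ> T" A
  by unfold_locales (use submodule in \<open>auto simp: fun_eq_iff theta_mult\<close>)

lemma induced_A_CG: "A.IND \<subseteq> CG"
  using A_commutant by (auto simp: induced_def)

abbreviation "conv_prod \<equiv> amult (induced_algebra G H sc ip \<theta> A)"
abbreviation "conv_star \<equiv> astar (induced_algebra G H sc ip \<theta> A)"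

text \<open>The convolution product is pointwise application of the convolution operator.\<close>

lemma conv_prod_apply: "conv_prod \<phi> \<psi> g x = conv_op G H \<phi> (\<lambda>k. \<psi> k x) g"
  by (simp add: induced_algebra_def conv_op_def)

lemma translate_in_induced:
  assumes "\<psi> \<in> CG" "k \<in> carrier G"
  shows "(\<lambda>g. if g \<in> carrier G then \<psi> (g \<otimes> k) x else 0) \<in> HG.IND"
  using assms(2) by (simp add: induced_def mult_H_swap [of _ k] CG_mult [OF assms(1)])

lemma eval_in_induced: "\<psi> \<in> CG \<Longrightarrow> (\<lambda>g. \<psi> g x) \<in> HG.IND"
  by (simp add: induced_def)

lemma conv_prod_in_induced:
  assumes \<phi>: "\<phi> \<in> A.IND" and \<psi>: "\<psi> \<in> A.IND"
  shows "conv_prod \<phi> \<psi> \<in> A.IND"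
proof -
  have CG: "\<phi> \<in> CG" "\<psi> \<in> CG" using assms induced_A_CG by blast+
  have "conv_prod \<phi> \<psi> g \<in> A" if "g \<in> carrier G" for g
  proof -
    have "conv_prod \<phi> \<psi> g = (\<Sum>a<m. \<phi> (g \<otimes> inv (rep a)) \<circ> \<psi> (rep a))"
      using that by (simp add: fun_eq_iff conv_prod_apply conv_op_eq CG eval_in_induced sum_fun_apply)
    also have "\<dots> \<in> A"
      using that by (intro A_sum A_comp A.inducedD(1) [OF \<phi>] A.inducedD(1) [OF \<psi>]) simp_all
    finally show ?thesis .
  qed
  moreover have "conv_prod \<phi> \<psi> (g \<otimes> h) = \<theta> (inv h) \<circ> conv_prod \<phi> \<psi> g"
    if "g \<in> carrier G" "h \<in> H" for g h
    using HG.inducedD(3) [OF conv_op_in_induced [OF CG(1) eval_in_induced [OF CG(2)]] that]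
    by (simp add: fun_eq_iff conv_prod_apply)
  moreover have "conv_prod \<phi> \<psi> g = 0" if "g \<notin> carrier G" for g
    using that by (simp add: fun_eq_iff conv_prod_apply conv_op_def)
  ultimately show ?thesis by (simp add: induced_def)
qed

lemma adjoint_theta_comp:
  assumes "h \<in> H" "T \<in> A"
  shows "adjoint_op ip (\<theta> h \<circ> T) = \<theta> (inv h) \<circ> adjoint_op ip T"
proof (rule adjoint_op_eqI)
  fix x y
  have comm: "\<theta> (inv h) (adjoint_op ip T y) = adjoint_op ip T (\<theta> (inv h) y)"
    using A_adjoint [OF assms(2)] A_commutant assms(1) by (auto simp: commutant_def fun_eq_iff)
  have "ip ((\<theta> h \<circ> T) x) y = ip (\<theta> h (T x)) (\<theta> h (\<theta> (inv h) y))"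
    using assms(1) by (simp add: theta_inv)
  also have "\<dots> = ip x (adjoint_op ip T (\<theta> (inv h) y))"
    using assms by (simp add: ip_theta ip_adjoint_op A_ops)
  finally show "ip ((\<theta> h \<circ> T) x) y = ip x ((\<theta> (inv h) \<circ> adjoint_op ip T) y)"
    by (simp add: comm)
qed

lemma conv_star_in_induced:
  assumes \<phi>: "\<phi> \<in> A.IND"
  shows "conv_star \<phi> \<in> A.IND"
proof -
  have "adjoint_op ip (\<phi> (inv (g \<otimes> h))) = \<theta> (inv h) \<circ> adjoint_op ip (\<phi> (inv g))"
    if g: "g \<in> carrier G" and h: "h \<in> H" for g h
  proof -
    have "inv (g \<otimes> h) = inv g \<otimes> inv h"
      using g h H_commute [of "inv h" "inv g"] by (simp add: inv_mult_group)
    then have "\<phi> (inv (g \<otimes> h)) = \<theta> h \<circ> \<phi> (inv g)"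
      using A.inducedD(3) [OF \<phi>, of "inv g" "inv h"] g h by simp
    then show ?thesis
      using adjoint_theta_comp [OF h] A.inducedD(1) [OF \<phi>, of "inv g"] g by simp
  qed
  then show ?thesis
    using A.inducedD(1) [OF \<phi>] by (auto simp: induced_def induced_algebra_def intro: A_adjoint)
qed

text \<open>For fixed \<open>j\<close> and \<open>x\<close>, the vectors \<open>\<psi>(g\<^sub>l g\<^sub>j\<^sup>-\<^sup>1) x\<close> are the values at the representatives of
  an element of the induced Hilbert space, to which the convolution operator of \<open>\<phi>\<close> is applied.\<close>

lemma coset_matrix_mult:
  assumes \<phi>: "\<phi> \<in> A.IND" and \<psi>: "\<psi> \<in> A.IND"
  shows "amult (mat_algebra m B) (A.cmat \<phi>) (A.cmat \<psi>) = A.cmat (conv_prod \<phi> \<psi>)"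
proof -
  have CG: "\<phi> \<in> CG" "\<psi> \<in> CG" using assms induced_A_CG by blast+
  have "(\<Sum>l<m. \<phi> (rep i \<otimes> inv (rep l)) (\<psi> (rep l \<otimes> inv (rep j)) x))
      = conv_prod \<phi> \<psi> (rep i \<otimes> inv (rep j)) x" if ij: "i < m" "j < m" for i j x
  proof -
    define \<xi> where "\<xi> = (\<lambda>g. if g \<in> carrier G then \<psi> (g \<otimes> inv (rep j)) x else 0)"
    have "(\<Sum>l<m. \<phi> (rep i \<otimes> inv (rep l)) (\<psi> (rep l \<otimes> inv (rep j)) x))
        = (\<Sum>l<m. \<phi> (rep i \<otimes> inv (rep l)) (\<xi> (rep l)))"
      by (rule sum.cong) (simp_all add: \<xi>_def)
    also have "\<dots> = conv_op G H \<phi> \<xi> (rep i)"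
      unfolding \<xi>_def using ij by (intro conv_op_eq [symmetric] translate_in_induced CG) simp_all
    also have "\<dots> = conv_prod \<phi> \<psi> (rep i \<otimes> inv (rep j)) x"
      using ij by (simp add: conv_prod_apply conv_op_def \<xi>_def m_assoc)
    finally show ?thesis .
  qed
  then show ?thesis
    by (simp add: fun_eq_iff coset_matrix_def bounded_ops_def sum_fun_apply)
qed

lemma coset_matrix_star:
  "astar (mat_algebra m B) (A.cmat \<phi>) = A.cmat (conv_star \<phi>)"
  by (simp add: fun_eq_iff coset_matrix_def bounded_ops_def induced_algebra_def inv_mult_group)

lemma matrix_form_obtain:
  assumes "M \<in> A.MF"
  obtains \<phi> where "\<phi> \<in> A.IND" "M = A.cmat \<phi>"
  by (rule that [OF A.coset_function_in_induced' [OF assms]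
        A.coset_matrix_function [OF assms, symmetric]])

lemma matrix_form_subspace: "module.subspace (smul (mat_algebra m B)) A.MF"
proof (rule module.subspaceI [OF module_mats])
  show "0 \<in> A.MF"
    by (simp add: A.matrix_form_iff mats_def A_zero fun_eq_iff theta_zero h_elem_def)
  show "M + N \<in> A.MF" if "M \<in> A.MF" "N \<in> A.MF" for M N
  proof -
    obtain \<phi> where \<phi>: "\<phi> \<in> A.IND" "M = A.cmat \<phi>"
      using \<open>M \<in> A.MF\<close> by (rule matrix_form_obtain)
    obtain \<psi> where \<psi>: "\<psi> \<in> A.IND" "N = A.cmat \<psi>"
      using \<open>N \<in> A.MF\<close> by (rule matrix_form_obtain)
    have "\<phi> + \<psi> \<in> A.IND"
      using \<phi>(1) \<psi>(1) by (simp add: induced_def A_add) (simp add: fun_eq_iff theta_add)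
    moreover have "M + N = A.cmat (\<phi> + \<psi>)"
      unfolding \<phi> \<psi> by (simp add: coset_matrix_def fun_eq_iff)
    ultimately show ?thesis using A.coset_matrix_in_matrix_form by simp
  qed
  show "smul (mat_algebra m B) c M \<in> A.MF" if "M \<in> A.MF" for c M
  proof -
    obtain \<phi> where *: "\<phi> \<in> A.IND" "M = A.cmat \<phi>"
      using \<open>M \<in> A.MF\<close> by (rule matrix_form_obtain)
    then have "(\<lambda>g x. sc c (\<phi> g x)) \<in> A.IND"
      by (simp add: induced_def A_scale) (simp add: fun_eq_iff theta_scale)
    moreover have "smul (mat_algebra m B) c M = A.cmat (\<lambda>g x. sc c (\<phi> g x))"
      unfolding * by (simp add: coset_matrix_def fun_eq_iff bounded_ops_def)
    ultimately show ?thesis using A.coset_matrix_in_matrix_form by simp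
  qed
qed

text \<open>Convergence in the norm of \<open>M\<^sub>m\<close> implies entrywise norm convergence, hence entrywise pointwise
  convergence.  The entries of the limit thus commute with \<open>\<theta>(H)\<close>, lie in \<open>A\<close>, and satisfy the
  relations that define the matrix form.\<close>

lemma matrix_form_closed:
  assumes F: "\<And>n. F n \<in> A.MF" and M: "M \<in> mats m (elts B)"
    and lim: "(\<lambda>n. elt_norm (mat_algebra m B) (F n - M)) \<longlonglongrightarrow> 0"
  shows "M \<in> A.MF"
proof -
  have FA: "F n i j \<in> A" if "i < m" "j < m" for n i j
    using F A.matrix_form_subset that by (auto simp: mats_def)
  have MB: "M i j \<in> elts B" if "i < m" "j < m" for i j
    using M that by (simp add: mats_def)
  have sub: "S - T \<in> elts B" if "S \<in> elts B" "T \<in> elts B" for S T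
    using that by (simp add: bounded_ops_def fun_diff_def bounded_linear_sub scale_right_diff_distrib)
  have diff: "F n - M \<in> mats m (elts B)" for n
  proof -
    have "F n i j = 0" if "\<not> (i < m \<and> j < m)" for i j
      using F [of n] A.matrix_form_subset that unfolding mats_def by blast
    then show ?thesis using M FA [of _ _ n] MB by (simp add: mats_def sub A_ops)
  qed
  have bl: "bounded_linear (F n i j - M i j)" if "i < m" "j < m" for n i j
    using sub [OF A_ops [OF FA [OF that]] MB [OF that]] unfolding bounded_ops_def by simp
  have ent: "(\<lambda>n. elt_norm B (F n i j - M i j)) \<longlonglongrightarrow> 0" if "i < m" "j < m" for i j
  proof (rule tendsto_sandwich [OF _ _ tendsto_const lim])
    show "\<forall>\<^sub>F n in sequentially. 0 \<le> elt_norm B (F n i j - M i j)"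
      by (intro always_eventually allI elt_norm_nonneg bl that)
    show "\<forall>\<^sub>F n in sequentially.
        elt_norm B (F n i j - M i j) \<le> elt_norm (mat_algebra m B) (F n - M)"
      using elt_norm_entry_le [OF diff that] by (intro always_eventually allI) simp
  qed
  have pointwise: "(\<lambda>n. F n i j v) \<longlonglongrightarrow> M i j v" if "i < m" "j < m" for i j v
  proof (rule Lim_null [THEN iffD2], rule Lim_null_comparison)
    show "(\<lambda>n. elt_norm B (F n i j - M i j) * norm v) \<longlonglongrightarrow> 0"
      using tendsto_mult_right [OF ent [OF that], of "norm v"] by simp
    have "norm ((F n i j - M i j) v) \<le> elt_norm B (F n i j - M i j) * norm v" for n
      by (rule norm_le_elt_norm [OF bl [OF that]])
    then show "\<forall>\<^sub>F n in sequentially.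
        norm (F n i j v - M i j v) \<le> elt_norm B (F n i j - M i j) * norm v"
      by (intro always_eventually allI) simp
  qed
  have theta_lim: "(\<lambda>n. \<theta> h (F n i j v)) \<longlonglongrightarrow> \<theta> h (M i j v)"
    if "i < m" "j < m" "h \<in> H" for i j h v
    using that by (intro bounded_linear.tendsto [OF bounded_linear_theta] pointwise)
  have MA: "M i j \<in> A" if ij: "i < m" "j < m" for i j
  proof (rule A_closed [OF FA [OF ij] _ ent [OF ij]])
    have "M i j (\<theta> h v) = \<theta> h (M i j v)" if "h \<in> H" for h v
    proof (rule LIMSEQ_unique [OF pointwise [OF ij]])
      have "F n i j (\<theta> h v) = \<theta> h (F n i j v)" for n
        using FA [OF ij, of n] A_commutant that by (auto simp: commutant_def fun_eq_iff)
      then show "(\<lambda>n. F n i j (\<theta> h v)) \<longlonglongrightarrow> \<theta> h (M i j v)"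
        using theta_lim [OF ij that] by simp
    qed
    then show "M i j \<in> commutant sc ip H \<theta>"
      using MB [OF ij] by (simp add: commutant_def fun_eq_iff)
  qed
  show ?thesis
    unfolding A.matrix_form_iff
  proof (intro conjI allI impI)
    show "M \<in> mats m A" using M MA by (simp add: mats_def)
    fix i j assume ij: "i < m" "j < m"
    have r: "r_index G H m rep i j < m" "inv (h_elem G H m rep i j) \<in> H"
      using ij by (simp_all add: r_index_def h_elem_def)
    show "M i j = \<theta> (inv (h_elem G H m rep i j)) \<circ> M (r_index G H m rep i j) 0"
    proof
      fix v
      have "F n i j = \<theta> (inv (h_elem G H m rep i j)) \<circ> F n (r_index G H m rep i j) 0" for n
        using F [of n] ij unfolding A.matrix_form_iff by blast
      then have "F n i j v = \<theta> (inv (h_elem G H m rep i j)) (F n (r_index G H m rep i j) 0 v)" for n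
        by (metis comp_apply)
      with theta_lim [OF r(1) m_pos r(2), of v]
      have "(\<lambda>n. F n i j v) \<longlonglongrightarrow> \<theta> (inv (h_elem G H m rep i j)) (M (r_index G H m rep i j) 0 v)"
        by presburger
      then show "M i j v = (\<theta> (inv (h_elem G H m rep i j)) \<circ> M (r_index G H m rep i j) 0) v"
        using LIMSEQ_unique [OF pointwise [OF ij]] by simp
    qed
  qed
qed

lemma matrix_form_cstar: "cstar_subalgebra (mat_algebra m B) A.MF"
  unfolding cstar_subalgebra_def
proof (intro conjI ballI allI impI)
  show "A.MF \<subseteq> elts (mat_algebra m B)"
  proof
    fix M assume "M \<in> A.MF"
    then have "M \<in> mats m A" using A.matrix_form_subset by blast
    then show "M \<in> elts (mat_algebra m B)" by (simp add: mats_def A_ops)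
  qed
  show "module.subspace (smul (mat_algebra m B)) A.MF" by (rule matrix_form_subspace)
  fix M assume M: "M \<in> A.MF"
  then obtain \<phi> where \<phi>: "\<phi> \<in> A.IND" "M = A.cmat \<phi>" by (rule matrix_form_obtain)
  show "astar (mat_algebra m B) M \<in> A.MF"
    unfolding \<phi>(2) coset_matrix_star
    by (rule A.coset_matrix_in_matrix_form [OF conv_star_in_induced [OF \<phi>(1)]])
  fix N assume "N \<in> A.MF"
  then obtain \<psi> where \<psi>: "\<psi> \<in> A.IND" "N = A.cmat \<psi>" by (rule matrix_form_obtain)
  show "amult (mat_algebra m B) M N \<in> A.MF"
    unfolding \<phi>(2) \<psi>(2) coset_matrix_mult [OF \<phi>(1) \<psi>(1)]
    by (rule A.coset_matrix_in_matrix_form [OF conv_prod_in_induced [OF \<phi>(1) \<psi>(1)]])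
next
  fix F M
  assume M: "M \<in> elts (mat_algebra m B)"
    and F: "(\<forall>n. F n \<in> A.MF) \<and> (\<lambda>n. elt_norm (mat_algebra m B) (F n - M)) \<longlonglongrightarrow> 0"
  show "M \<in> A.MF"
  proof (rule matrix_form_closed)
    show "F n \<in> A.MF" for n using F by blast
    show "M \<in> mats m (elts B)" using M by simp
    show "(\<lambda>n. elt_norm (mat_algebra m B) (F n - M)) \<longlonglongrightarrow> 0" by (rule conjunct2 [OF F])
  qed
qed

lemma matrix_form_star_isomorphic:
  "star_isomorphic ((mat_algebra m B)\<lparr>elts := A.MF\<rparr>) (induced_algebra G H sc ip \<theta> A)"
  unfolding star_isomorphic_def
proof (intro exI [of _ A.cfun] conjI ballI)
  have IND: "elts (induced_algebra G H sc ip \<theta> A) = A.IND" by (simp add: induced_algebra_def)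
  show "bij_betw A.cfun (elts ((mat_algebra m B)\<lparr>elts := A.MF\<rparr>)) (elts (induced_algebra G H sc ip \<theta> A))"
    using A.bij_coset_function by (simp add: IND)
  show "linear_between ((mat_algebra m B)\<lparr>elts := A.MF\<rparr>) (induced_algebra G H sc ip \<theta> A) A.cfun"
    unfolding linear_between_def
  proof (intro conjI ballI allI)
    show "A.cfun \<in> elts ((mat_algebra m B)\<lparr>elts := A.MF\<rparr>) \<rightarrow> elts (induced_algebra G H sc ip \<theta> A)"
      using A.coset_function_in_induced' by (simp add: IND)
    fix M assume M: "M \<in> elts ((mat_algebra m B)\<lparr>elts := A.MF\<rparr>)"
    show "A.cfun (M + N) = A.cfun M + A.cfun N"
      if "N \<in> elts ((mat_algebra m B)\<lparr>elts := A.MF\<rparr>)" for N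
      using M that by (intro A.coset_function_add) (simp_all add: fun_eq_iff theta_add)
    show "A.cfun (smul ((mat_algebra m B)\<lparr>elts := A.MF\<rparr>) c M)
        = smul (induced_algebra G H sc ip \<theta> A) c (A.cfun M)" for c
      using A.coset_function_scale [of "\<lambda>T x. sc c (T x)" M] M
      by (simp add: fun_eq_iff theta_scale bounded_ops_def induced_algebra_def)
  qed
  fix M assume M: "M \<in> elts ((mat_algebra m B)\<lparr>elts := A.MF\<rparr>)"
  then obtain \<phi> where \<phi>: "\<phi> \<in> A.IND" "M = A.cmat \<phi>" by (simp, elim matrix_form_obtain)
  show "A.cfun (astar ((mat_algebra m B)\<lparr>elts := A.MF\<rparr>) M) = conv_star (A.cfun M)"
  proof -
    have "A.cfun (astar (mat_algebra m B) M) = conv_star (A.cfun M)"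
      unfolding \<phi>(2) coset_matrix_star
      by (simp only: A.coset_function_matrix conv_star_in_induced \<phi>(1))
    then show ?thesis by simp
  qed
  fix N assume N: "N \<in> elts ((mat_algebra m B)\<lparr>elts := A.MF\<rparr>)"
  then obtain \<psi> where \<psi>: "\<psi> \<in> A.IND" "N = A.cmat \<psi>" by (simp, elim matrix_form_obtain)
  have "A.cfun (amult (mat_algebra m B) M N) = conv_prod (A.cfun M) (A.cfun N)"
    unfolding \<phi>(2) \<psi>(2) coset_matrix_mult [OF \<phi>(1) \<psi>(1)]
    by (simp only: A.coset_function_matrix conv_prod_in_induced \<phi>(1) \<psi>(1))
  then show "A.cfun (amult ((mat_algebra m B)\<lparr>elts := A.MF\<rparr>) M N) = conv_prod (A.cfun M) (A.cfun N)"
    by simp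
qed

end

section \<open>The matrix form of a central operator space\<close>

context central_cosets
begin

lemma mult_inv_same_coset:
  assumes "g \<in> carrier G" "k \<in> carrier G" "idx k = idx g"
  shows "k \<otimes> inv g = hpt k \<otimes> inv (hpt g)"
proof -
  define r where "r = rep (idx g)"
  have r: "r \<in> carrier G" and g: "r \<otimes> hpt g = g" and k: "r \<otimes> hpt k = k"
    using assms rep_H_part [of g] rep_H_part [of k] by (simp_all add: r_def)
  have H: "hpt g \<in> H" "hpt k \<in> H" using assms by simp_all
  have "k \<otimes> inv g = (r \<otimes> hpt k) \<otimes> inv (r \<otimes> hpt g)" unfolding g k ..
  also have "\<dots> = r \<otimes> (hpt k \<otimes> inv (hpt g)) \<otimes> inv r"
    using r H by (simp add: inv_mult_group m_assoc)
  also have "\<dots> = (hpt k \<otimes> inv (hpt g)) \<otimes> r \<otimes> inv r"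
    using r H by (simp only: H_commute [of "hpt k \<otimes> inv (hpt g)" r] H.m_closed H.m_inv_closed)
  also have "\<dots> = hpt k \<otimes> inv (hpt g)"
    using r H by (simp add: m_assoc)
  finally show ?thesis .
qed

lemma mult_inv_in_H_iff:
  assumes "g \<in> carrier G" "k \<in> carrier G"
  shows "k \<otimes> inv g \<in> H \<longleftrightarrow> idx k = idx g"
proof
  assume "k \<otimes> inv g \<in> H"
  then have "idx (g \<otimes> (k \<otimes> inv g)) = idx g" using assms by simp
  moreover have "g \<otimes> (k \<otimes> inv g) = k"
    using H_commute [OF \<open>k \<otimes> inv g \<in> H\<close> assms(1)] assms by (simp add: m_assoc)
  ultimately show "idx k = idx g" by simp
qed (simp add: assms mult_inv_same_coset)

end

text \<open>A central \<open>H\<close>-modular operator space with a fixed central representation.\<close>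

locale central_module = central_rep G H m rep sc ip \<theta>
  for G :: "('g, 'b) monoid_scheme" (structure) and H m rep
    and sc :: "'k::real_or_complex \<Rightarrow> 'h::banach \<Rightarrow> 'h" and ip \<theta> +
  fixes X :: "('k, 'x::ab_group_add) op_space" and act :: "'g \<Rightarrow> 'x \<Rightarrow> 'x"
    and \<rho> :: "'x \<Rightarrow> 'h \<Rightarrow> 'h"
  assumes modular: "central_H_modular_via G H X act sc ip \<theta> \<rho>"
begin

lemma vector_space_X: "vector_space (smul X)"
  and subspace_X: "module.subspace (smul X) (elts X)"
  and rho_isometry: "complete_isometry X (bounded_ops sc ip) \<rho>"
  and action_X: "isometric_action G H X act"
  and rho_act: "h \<in> H \<Longrightarrow> x \<in> elts X \<Longrightarrow> \<rho> (act h x) = \<theta> h \<circ> \<rho> x"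
    "h \<in> H \<Longrightarrow> x \<in> elts X \<Longrightarrow> \<rho> (act h x) = \<rho> x \<circ> \<theta> h"
  using modular unfolding central_H_modular_via_def operator_space_via_def by blast+

lemma module_X: "module (smul X)"
  using vector_space_X by (simp add: module_iff_vector_space)

lemma zero_in_X [simp]: "0 \<in> elts X"
  by (rule module.subspace_0 [OF module_X subspace_X])

lemma smul_zero: "smul X c 0 = 0"
  by (rule module.scale_zero_right [OF module_X])

lemma act_linear: "h \<in> H \<Longrightarrow> linear_between X X (act h)"
  using action_X by (simp add: isometric_action_def complete_isometry_def)

lemma act_add: "h \<in> H \<Longrightarrow> x \<in> elts X \<Longrightarrow> y \<in> elts X \<Longrightarrow> act h (x + y) = act h x + act h y"
  and act_smul: "h \<in> H \<Longrightarrow> x \<in> elts X \<Longrightarrow> act h (smul X c x) = smul X c (act h x)"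
  using act_linear unfolding linear_between_def by blast+

lemma act_zero: "h \<in> H \<Longrightarrow> act h 0 = 0"
  using act_add [of h 0 0] by simp

lemma rho_bounded_ops: "x \<in> elts X \<Longrightarrow> \<rho> x \<in> elts (bounded_ops sc ip)"
  using rho_isometry unfolding complete_isometry_def linear_between_def by blast

lemma rho_zero: "\<rho> 0 = 0"
proof -
  have "\<rho> (0 + 0) = \<rho> 0 + \<rho> 0"
    using rho_isometry zero_in_X unfolding complete_isometry_def linear_between_def by blast
  then show ?thesis by simp
qed

lemma rho_mnorm:
  assumes "x \<in> mats n (elts X)" "1 \<le> n"
  shows "mat_opnorm UNIV norm n (\<lambda>i j. \<rho> (x i j)) = mnorm X n x"
proof -
  have "mnorm (bounded_ops sc ip) n (\<lambda>i j. \<rho> (x i j)) = mnorm X n x"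
    using rho_isometry assms unfolding complete_isometry_def by blast
  then show ?thesis by (simp add: bounded_ops_def)
qed

sublocale X: central_action G H m rep act "elts X"
proof
  show "act h x \<in> elts X" if "h \<in> H" "x \<in> elts X" for h x
    using act_linear [OF that(1)] that(2) unfolding linear_between_def by blast
qed (use action_X in \<open>simp_all add: isometric_action_def\<close>)

lemma rho_induced:
  assumes \<phi>: "\<phi> \<in> X.IND"
  shows "(\<lambda>g. \<rho> (\<phi> g)) \<in> CG"
proof -
  have "\<rho> x \<in> commutant sc ip H \<theta>" if "x \<in> elts X" for x
    using that rho_bounded_ops rho_act by (auto simp: commutant_def)
  then show ?thesis
    using X.inducedD [OF \<phi>] by (auto simp: induced_def rho_zero rho_act(1))
qed

text \<open>\<^const>\<open>coset_function\<close> is completely isometric on the matrix form: the norms of \<open>X\<^sub>G\<close> and of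
  \<open>M\<^sub>m(X)\<close> at level \<open>n\<close> are compared through \<open>\<rho>\<close>, which preserves the norm of matrices of size
  \<open>nm\<close>.\<close>

lemma coset_function_norm:
  assumes n: "1 \<le> n" and Y: "Y \<in> mats n X.MF"
  shows "induced_opnorm G H \<theta> n (\<lambda>i j. conv_op G H (\<lambda>g. \<rho> (X.cfun (Y i j) g)))
       = mnorm X (n * m) (flatten n m Y)"
proof -
  have YM: "Y i j \<in> X.MF" if "i < n" "j < n" for i j using Y that by (simp add: mats_def)
  have block: "p div m < n" "p mod m < m" if "p < n * m" for p
    using that m_pos by (simp_all add: less_mult_imp_div_less)
  have fl: "flatten n m Y \<in> mats (n * m) (elts X)"
    using YM X.matrix_form_subset block unfolding mats_def flatten_def by (simp add: subset_iff)
  have "induced_opnorm G H \<theta> n (\<lambda>i j. conv_op G H (\<lambda>g. \<rho> (X.cfun (Y i j) g)))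
      = mat_opnorm UNIV norm (n * m)
          (flatten n m (\<lambda>i j. coset_matrix G m rep (\<lambda>g. \<rho> (X.cfun (Y i j) g))))"
    by (intro induced_opnorm_eq rho_induced X.coset_function_in_induced' YM)
  also have "flatten n m (\<lambda>i j. coset_matrix G m rep (\<lambda>g. \<rho> (X.cfun (Y i j) g)))
      = (\<lambda>p q. \<rho> (flatten n m Y p q))"
    by (intro ext) (simp add: flatten_def coset_matrix_def rho_zero block YM
        X.coset_function_entry)
  also have "mat_opnorm UNIV norm (n * m) \<dots> = mnorm X (n * m) (flatten n m Y)"
    using n m_pos by (intro rho_mnorm fl) (simp add: Suc_le_eq)
  finally show ?thesis .
qed

lemma right_mult_I_tensor:
  assumes "x \<in> elts X" and "\<And>l w. W l j = Some w \<Longrightarrow> l < m \<Longrightarrow> w \<in> H" and "i < m" "j < m"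
  shows "right_mult m act (I_tensor m x) W i j = opt_act act (W i j) x"
proof -
  have zero: "opt_act act (W l j) 0 = 0" if "l < m" for l
    using assms(2) that by (auto simp: opt_act_def act_zero split: option.split)
  have "(\<Sum>l<m. opt_act act (W l j) (I_tensor m x i l))
      = (\<Sum>l<m. if l = i then opt_act act (W i j) x else 0)"
    using assms(3) by (intro sum.cong) (auto simp: I_tensor_def zero)
  then show ?thesis using assms(3,4) by (simp add: right_mult_def)
qed

lemma right_mult_I_tensor_H:
  assumes "i < m" "j < m"
  shows "right_mult m act Y (I_tensor_H h) i j = act h (Y i j)"
proof -
  have "(\<Sum>l<m. opt_act act (I_tensor_H h l j) (Y i l))
      = (\<Sum>l<m. if l = j then act h (Y i j) else 0)"
    by (intro sum.cong) (auto simp: I_tensor_H_def opt_act_def)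
  then show ?thesis using assms by (simp add: right_mult_def)
qed

text \<open>Both sides send \<open>k\<close> to \<open>h'\<^sup>-\<^sup>1 h x\<close> if \<open>g\<close> and \<open>k\<close> lie in the same coset and have \<open>H\<close>-parts
  \<open>h\<close> and \<open>h'\<close>, and to \<open>0\<close> otherwise.\<close>

lemma coset_function_translate:
  assumes x: "x \<in> elts X" and g: "g \<in> carrier G"
  shows "X.cfun (ract (matrix_gification G H m rep X act)
            (emb (matrix_gification G H m rep X act) x) g)
       = ract (induced_gification G H X act \<theta> \<rho>) (emb (induced_gification G H X act \<theta> \<rho>) x) g"
proof
  fix k
  define M where "M = right_mult m act
    (right_mult m act (I_tensor m x) (V_mat G H m rep (idx g))) (I_tensor_H (hpt g))"
  have "W \<in> H" if "V_mat G H m rep (idx g) l 0 = Some W" "l < m" for l W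
    using that m_pos by (auto simp: V_mat_def h_elem_def rep_0 split: if_splits)
  then have "right_mult m act (I_tensor m x) (V_mat G H m rep (idx g)) i 0
      = opt_act act (V_mat G H m rep (idx g) i 0) x" if "i < m" for i
    using x that m_pos by (intro right_mult_I_tensor) simp_all
  then have M: "M i 0 = (if i = idx g then act (hpt g) x else 0)" if "i < m" for i
    using that g x m_pos
    by (simp add: M_def right_mult_I_tensor_H V_mat_def opt_act_def r_index_def h_elem_def rep_0
        act_zero)
  show "X.cfun (ract (matrix_gification G H m rep X act)
            (emb (matrix_gification G H m rep X act) x) g) k
       = ract (induced_gification G H X act \<theta> \<rho>) (emb (induced_gification G H X act \<theta> \<rho>) x) g k"
  proof (cases "k \<in> carrier G")
    case True
    have "inv (hpt k \<otimes> inv (hpt g)) = inv (hpt k) \<otimes> hpt g"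
      using g True H_commute [of "hpt g" "inv (hpt k)"] by (simp add: inv_mult_group)
    then have "X.cfun M k = (if k \<otimes> inv g \<in> H then act (inv (k \<otimes> inv g)) x else 0)"
      using True g x
      by (simp add: coset_function_def M mult_inv_in_H_iff mult_inv_same_coset act_zero X.act_mult)
    then show ?thesis
      using True by (simp add: matrix_gification_def induced_gification_def M_def)
  next
    case False
    then show ?thesis by (simp add: coset_function_def induced_gification_def)
  qed
qed

lemma gifications_identified:
  "gifications_identified G X (matrix_gification G H m rep X act)
     (induced_gification G H X act \<theta> \<rho>)" (is "gifications_identified G X ?V ?W")
  unfolding gifications_identified_def
proof (intro exI [of _ X.cfun] conjI ballI)
  have V: "elts ?V = X.MF" "smul ?V = (\<lambda>c M i j. smul X c (M i j))"
    "mnorm ?V = (\<lambda>n Y. mnorm X (n * m) (flatten n m Y))"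
    by (simp_all add: matrix_gification_def mat_space_def)
  have W: "elts ?W = X.IND" "smul ?W = (\<lambda>c \<phi> g. smul X c (\<phi> g))"
    "mnorm ?W = (\<lambda>n \<Phi>. induced_opnorm G H \<theta> n (\<lambda>i j. conv_op G H (\<lambda>k. \<rho> (\<Phi> i j k))))"
    by (simp_all add: induced_gification_def)
  show "X.cfun ` elts ?V = elts ?W"
    using X.bij_coset_function by (simp add: V W bij_betw_imp_surj_on)
  have "linear_between ?V ?W X.cfun"
    unfolding linear_between_def V W
    by (intro conjI ballI allI X.coset_function_add X.coset_function_scale act_add act_smul
        smul_zero funcsetI X.coset_function_in_induced')
  moreover have "mnorm ?W n (\<lambda>i j. X.cfun (Y i j)) = mnorm ?V n Y"
    if "1 \<le> n" "Y \<in> mats n (elts ?V)" for n Y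
    using coset_function_norm that by (simp add: V W)
  ultimately show "complete_isometry ?V ?W X.cfun" unfolding complete_isometry_def by blast
qed (rule coset_function_translate)

end

section \<open>The identification\<close>

theorem theorem5p2:
  fixes G :: "('g, 'b) monoid_scheme" and H :: "'g set"
    and sc :: "'k::real_or_complex \<Rightarrow> 'h::banach \<Rightarrow> 'h" and ip :: "'h \<Rightarrow> 'h \<Rightarrow> 'k"
    and \<theta> :: "'g \<Rightarrow> 'h \<Rightarrow> 'h" and A :: "('h \<Rightarrow> 'h) set"
    and X :: "('k, 'x::ab_group_add) op_space" and act :: "'g \<Rightarrow> 'x \<Rightarrow> 'x"
    and sc\<^sub>0 :: "'k \<Rightarrow> 'h0::banach \<Rightarrow> 'h0" and ip\<^sub>0 :: "'h0 \<Rightarrow> 'h0 \<Rightarrow> 'k"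
    and \<theta>\<^sub>0 :: "'g \<Rightarrow> 'h0 \<Rightarrow> 'h0" and \<rho> :: "'x \<Rightarrow> 'h0 \<Rightarrow> 'h0"
    and m :: nat and rep :: "nat \<Rightarrow> 'g"
  assumes "group G" and "finite (carrier G)"
    and "subgroup H G" and "H \<subseteq> group_center G"
    and "hilbert_space sc ip" and "unitary_rep G H sc ip \<theta>" and "inj_on \<theta> H"
    and "cstar_subalgebra ((bounded_ops sc ip)\<lparr>elts := commutant sc ip H \<theta>\<rparr>) A"
    and "\<forall>h\<in>H. \<forall>T\<in>A. \<theta> h \<circ> T \<in> A"
    and "central_H_modular_via G H X act sc\<^sub>0 ip\<^sub>0 \<theta>\<^sub>0 \<rho>"
    and "coset_reps G H m rep"
  shows "matrix_form G H m rep (\<lambda>h T. \<theta> h \<circ> T) A \<subseteq> mats m A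
    \<and> cstar_subalgebra (mat_algebra m (bounded_ops sc ip))
         (matrix_form G H m rep (\<lambda>h T. \<theta> h \<circ> T) A)
    \<and> star_isomorphic
         ((mat_algebra m (bounded_ops sc ip))
            \<lparr>elts := matrix_form G H m rep (\<lambda>h T. \<theta> h \<circ> T) A\<rparr>)
         (induced_algebra G H sc ip \<theta> A)
    \<and> gifications_identified G X
         (matrix_gification G H m rep X act)
         (induced_gification G H X act \<theta>\<^sub>0 \<rho>)"
proof -
  interpret cosets: central_cosets G H m rep
    using assms by (intro central_cosets.intro central_cosets_axioms.intro)
  interpret A: central_subalgebra G H m rep sc ip \<theta> A
    using assms cosets.central_cosets_axioms
    by (intro central_subalgebra.intro central_subalgebra_axioms.intro central_rep.intro
        central_rep_axioms.intro)
  have "hilbert_space sc\<^sub>0 ip\<^sub>0" and "unitary_rep G H sc\<^sub>0 ip\<^sub>0 \<theta>\<^sub>0"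
    using assms(10) unfolding central_H_modular_via_def operator_space_via_def by blast+
  then interpret X: central_module G H m rep sc\<^sub>0 ip\<^sub>0 \<theta>\<^sub>0 X act \<rho>
    using assms(10) cosets.central_cosets_axioms
    by (intro central_module.intro central_module_axioms.intro central_rep.intro
        central_rep_axioms.intro)
  show ?thesis
    by (intro conjI A.A.matrix_form_subset A.matrix_form_cstar A.matrix_form_star_isomorphic
        X.gifications_identified)
qed

end
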